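(* For all integers $s\geq 2$ and $k\geq 3$, there exists $C>0$ such that the following holds. Let $p=p(n)\geq C n^{2-s-1/m_2(K_{k-1})}$ and $\mathcal{H} = \mathcal{H}_s(n,p)$. Then for every function $\varepsilon(n)\to 0$, with probability tending to $1$ as $n\to\infty$, every subhypergraph $\mathcal{H}_0 \subseteq \mathcal{H}$ with at least $(1 - \varepsilon(n))e(\mathcal{H})$ hyperedges satisfies $G[\mathcal{H}_0] \rightarrow (K_{s}, K_{k-1})$.
   Context: The maximum $2$-density of a graph $F$ is $m_2(F)=\max\{\frac{e(J)-1}{v(J)-2} : J\subseteq F,\ v(J)\geq 3\}$, where $e(J),v(J)$ are the numbers of edges and vertices of $J$. The random $s$-uniform hypergraph $\mathcal{H}_s(n,p)$ has vertex set of size $n$ and contains each $s$-element subset of vertices as a hyperedge independently with probability $p$; $e(\mathcal{H})$ denotes its number of hyperedges. For an $s$-uniform hypergraph $\mathcal{H}$, the primal graph $G[\mathcal{H}]$ has vertex set $V(\mathcal{H})$ and edge set all pairs of vertices contained together in some hyperedge of $\mathcal{H}$. For a graph $G$, $G \rightarrow (K_a,K_b)$ means every red-blue colouring of the edges of $G$ contains a red copy of $K_a$ or a blue copy of $K_b$.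
   Formalization: For k=3 the quantity m_2(K_2) is a maximum over an empty set and hence undefined; it is taken to be 1 (the value 1/2 would make the claim false). The bound on p(n) is required only for all sufficiently large n. *)

theory Defs
  imports "HOL-Probability.Probability"
begin

text \<open>A hypergraph is a pair of a vertex set and a set of hyperedges; a graph is a hypergraph all of
  whose hyperedges have exactly two elements.\<close>

type_synonym 'a hypergraph = "'a set \<times> 'a set set"

abbreviation verts :: "'a hypergraph \<Rightarrow> 'a set" where
  "verts H \<equiv> fst H"

abbreviation edges :: "'a hypergraph \<Rightarrow> 'a set set" where
  "edges H \<equiv> snd H"

definition subhypergraph :: "'a hypergraph \<Rightarrow> 'a hypergraph \<Rightarrow> bool" where
  "subhypergraph J H \<longleftrightarrow>
     verts J \<subseteq> verts H \<and> edges J \<subseteq> edges H \<and> (\<forall>e\<in>edges J. e \<subseteq> verts J)"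

definition hypergraph_iso :: "'a hypergraph \<Rightarrow> 'b hypergraph \<Rightarrow> bool" where
  "hypergraph_iso F J \<longleftrightarrow>
     (\<exists>f. bij_betw f (verts F) (verts J) \<and> edges J = (\<lambda>e. f ` e) ` edges F)"

definition complete_hypergraph :: "nat \<Rightarrow> nat \<Rightarrow> nat hypergraph" where
  "complete_hypergraph s n = ({..<n}, {e. e \<subseteq> {..<n} \<and> card e = s})"

abbreviation complete_graph :: "nat \<Rightarrow> nat hypergraph" where
  "complete_graph r \<equiv> complete_hypergraph 2 r"

text \<open>Meant for finite graphs. A graph on fewer than three vertices has no subgraph to maximise over;
  its maximum 2-density is set to 1. The other common convention, \<open>m\<^sub>2(K\<^sub>2) = 1/2\<close>, would give
  \<open>p = C n\<^bsup>-s\<^esup>\<close>, where the random hypergraph is edgeless with probability bounded away from 0.\<close>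

definition max_2_density :: "'a hypergraph \<Rightarrow> real" where
  "max_2_density F =
     (if card (verts F) < 3 then 1
      else Max {(real (card (edges J)) - 1) / (real (card (verts J)) - 2) | J.
                  subhypergraph J F \<and> card (verts J) \<ge> 3})"

definition primal_graph :: "'a hypergraph \<Rightarrow> 'a hypergraph" where
  "primal_graph H = (verts H, {{u, v} | u v. u \<noteq> v \<and> (\<exists>e\<in>edges H. u \<in> e \<and> v \<in> e)})"

datatype colour = Red | Blue

text \<open>Only the values of a colouring on the edges of \<open>G\<close> matter.\<close>

definition monochromatic_copy ::
  "'a hypergraph \<Rightarrow> ('a set \<Rightarrow> colour) \<Rightarrow> colour \<Rightarrow> 'b hypergraph \<Rightarrow> bool" where
  "monochromatic_copy G col c F \<longleftrightarrow>
     (\<exists>J. subhypergraph J G \<and> hypergraph_iso F J \<and> (\<forall>e\<in>edges J. col e = c))"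

definition ramsey_arrow :: "'a hypergraph \<Rightarrow> 'b hypergraph \<Rightarrow> 'c hypergraph \<Rightarrow> bool" where
  "ramsey_arrow G F1 F2 \<longleftrightarrow>
     (\<forall>col. monochromatic_copy G col Red F1 \<or> monochromatic_copy G col Blue F2)"

definition random_hypergraph :: "nat \<Rightarrow> nat \<Rightarrow> real \<Rightarrow> nat hypergraph pmf" where
  "random_hypergraph s n p =
     map_pmf (\<lambda>X. ({..<n}, {e \<in> edges (complete_hypergraph s n). X e}))
       (Pi_pmf (edges (complete_hypergraph s n)) False (\<lambda>_. bernoulli_pmf p))"

end

theory Submission
  imports Defs "HOL-Library.Ramsey"
begin

text \<open>
  Put \<open>r = k - 1\<close>. If \<open>H\<^sub>0\<close> has a colouring with no red \<open>K\<^sub>s\<close> and no blue \<open>K\<^sub>r\<close>, then the blue graph \<open>B\<close> is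
  \<open>K\<^sub>r\<close>-free and every hyperedge of \<open>H\<^sub>0\<close> contains an edge of \<open>B\<close>. By the hypergraph container method,
  \<open>B\<close> lies in a graph \<open>C\<close> with few copies of \<open>K\<^sub>r\<close> that is determined by boundedly many fingerprints,
  subsets of \<open>B\<close> of size \<open>O(n powr (2 - 1/m\<^sub>2(K\<^sub>r)))\<close>. By Ramsey's theorem and averaging, a positive
  proportion of all \<open>s\<close>-sets spans no edge of \<open>C\<close>; none of these is in \<open>H\<^sub>0\<close>, so almost none of them is
  in \<open>H\<close>, which for a fixed \<open>C\<close> has probability \<open>exp (- \<Omega>(p n\<^sup>s))\<close>. The fingerprints are covered by
  few hyperedges of \<open>H\<^sub>0\<close>, disjoint from those \<open>s\<close>-sets. In the union bound over the fingerprints these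
  covering hyperedges contribute a factor \<open>p\<close> each, so for a large constant in the lower bound on \<open>p\<close> the number of
  fingerprints is outweighed by that exponential.
\<close>

section \<open>Hypergraph containers\<close>

definition deg :: "'a set set \<Rightarrow> 'a set \<Rightarrow> nat" where
  "deg H S = card {h \<in> H. S \<subseteq> h}"

definition indep_sets :: "'a set \<Rightarrow> 'a set set \<Rightarrow> 'a set set" where
  "indep_sets V H = {I. I \<subseteq> V \<and> (\<forall>h\<in>H. \<not> h \<subseteq> I)}"

text \<open>The list \<open>L\<close> consists of fingerprints inside \<open>I\<close>; the container \<open>f L\<close> depends on nothing else.\<close>

definition fits :: "real \<Rightarrow> nat \<Rightarrow> ('a set list \<Rightarrow> 'a set) \<Rightarrow> ('a set \<Rightarrow> bool) \<Rightarrow> 'a set \<Rightarrow> bool" where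
  "fits t m f Q I \<longleftrightarrow>
     (\<exists>L. length L = m \<and> (\<forall>F\<in>set L. F \<subseteq> I \<and> real (card F) \<le> t) \<and> I \<subseteq> f L \<and> Q (f L))"

text \<open>One function \<open>f\<close> serves the whole family, so the containers are no more
  numerous than the lists of \<open>m\<close> fingerprints. A union bound can therefore run over
  lists instead of over members of the family.\<close>

definition has_containers ::
  "real \<Rightarrow> nat \<Rightarrow> 'a set set \<Rightarrow> ('a set \<Rightarrow> bool) \<Rightarrow> bool" where
  "has_containers t m \<I> Q \<longleftrightarrow> (\<exists>f. \<forall>I\<in>\<I>. fits t m f Q I)"

text \<open>A constant container function works. Lists must have length exactly \<open>m\<close>, so
  they are padded with empty fingerprints, which \<open>0 \<le> t\<close> admits.\<close>

lemma has_containers_const: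
  assumes "\<And>I. I \<in> \<I> \<Longrightarrow> I \<subseteq> C \<and> Q C" and "0 \<le> t"
  shows "has_containers t m \<I> Q"
  unfolding has_containers_def fits_def
  by (intro exI[of _ "\<lambda>_. C"] ballI, rule_tac x = "replicate m {}" in exI) (use assms in auto)

lemma has_containers_mono:
  assumes "has_containers t m \<I> Q" and "\<And>C. Q C \<Longrightarrow> Q' C" and "t \<le> t'"
  shows "has_containers t' m \<I> Q'"
proof -
  have "fits t' m f Q' I" if "fits t m f Q I" for f I
  proof -
    from that obtain L where "length L = m" "\<forall>F\<in>set L. F \<subseteq> I \<and> real (card F) \<le> t"
      "I \<subseteq> f L" "Q (f L)" unfolding fits_def by (elim exE conjE)
    with assms(2,3) show ?thesis unfolding fits_def by (intro exI[of _ L]) force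
  qed
  moreover from assms(1) obtain f where "\<forall>I\<in>\<I>. fits t m f Q I"
    unfolding has_containers_def ..
  ultimately have "\<forall>I\<in>\<I>. fits t' m f Q' I" by simp
  then show ?thesis unfolding has_containers_def by (rule exI[of _ f])
qed

lemma has_containers_subset:
  assumes "has_containers t m \<J> Q" and "\<I> \<subseteq> \<J>"
  shows "has_containers t m \<I> Q"
proof -
  from assms(1) obtain f where "\<forall>I\<in>\<J>. fits t m f Q I"
    unfolding has_containers_def ..
  with assms(2) have "\<forall>I\<in>\<I>. fits t m f Q I" by auto
  then show ?thesis unfolding has_containers_def by (rule exI[of _ f])
qed

text \<open>The new fingerprint \<open>F\<close> becomes the head of the list. It selects the
  container function of the subfamily \<open>\<J> F\<close>, which then reads the tail.\<close>

lemma has_containers_Suc: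
  assumes F: "\<And>I. I \<in> \<I> \<Longrightarrow> \<exists>F. F \<subseteq> I \<and> real (card F) \<le> t \<and> I \<in> \<J> F"
    and J: "\<And>F. has_containers t m (\<J> F) Q"
  shows "has_containers t (Suc m) \<I> Q"
proof -
  have "\<forall>F. \<exists>g. \<forall>I\<in>\<J> F. fits t m g Q I"
    using J by (simp add: has_containers_def)
  from choice[OF this] obtain g where g: "\<forall>F. \<forall>I\<in>\<J> F. fits t m (g F) Q I" ..
  have "fits t (Suc m) (\<lambda>L. g (hd L) (tl L)) Q I" if "I \<in> \<I>" for I
  proof -
    from F[OF that] obtain F where F1: "F \<subseteq> I" "real (card F) \<le> t" "I \<in> \<J> F"
      by (elim exE conjE)
    have "fits t m (g F) Q I" using g F1(3) by auto
    then obtain L where "length L = m" "\<forall>F\<in>set L. F \<subseteq> I \<and> real (card F) \<le> t"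
      "I \<subseteq> g F L" "Q (g F L)" unfolding fits_def by (elim exE conjE)
    with F1 show ?thesis
      unfolding fits_def by (intro exI[of _ "F # L"]) auto
  qed
  then show ?thesis unfolding has_containers_def by (intro exI ballI)
qed

text \<open>The first \<open>m\<close> fingerprints determine a container \<open>C\<close>, and
  \<open>C\<close> alone determines the function that reads the remaining \<open>m'\<close>. This is
  what allows a container to be refined repeatedly.\<close>

lemma has_containers_trans:
  assumes Q: "has_containers t m \<I> Q"
    and Q': "\<And>C. Q C \<Longrightarrow> has_containers t m' {I \<in> \<I>. I \<subseteq> C} Q'"
  shows "has_containers t (m + m') \<I> Q'"
proof -
  from Q obtain f where f: "\<forall>I\<in>\<I>. fits t m f Q I"
    unfolding has_containers_def ..
  have "\<forall>C. \<exists>g. Q C \<longrightarrow> (\<forall>I\<in>{I \<in> \<I>. I \<subseteq> C}. fits t m' g Q' I)"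
    using Q' by (simp add: has_containers_def)
  from choice[OF this] obtain g
    where g: "\<forall>C. Q C \<longrightarrow> (\<forall>I\<in>{I \<in> \<I>. I \<subseteq> C}. fits t m' (g C) Q' I)" ..
  have "fits t (m + m') (\<lambda>L. g (f (take m L)) (drop m L)) Q' I" if I: "I \<in> \<I>" for I
  proof -
    obtain L where L: "length L = m" "\<forall>F\<in>set L. F \<subseteq> I \<and> real (card F) \<le> t"
      "I \<subseteq> f L" "Q (f L)" using bspec[OF f I] unfolding fits_def by (elim exE conjE)
    then have "fits t m' (g (f L)) Q' I" using g I by auto
    then obtain L' where "length L' = m'" "\<forall>F\<in>set L'. F \<subseteq> I \<and> real (card F) \<le> t"
      "I \<subseteq> g (f L) L'" "Q' (g (f L) L')" unfolding fits_def by (elim exE conjE)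
    with L show ?thesis
      unfolding fits_def by (intro exI[of _ "L @ L'"]) auto
  qed
  then show ?thesis unfolding has_containers_def by (intro exI ballI)
qed

text \<open>One level of the container construction: links in \<open>H\<close> of the vertices of a fingerprint \<open>F\<close> are
  collected into a hypergraph \<open>G\<close> of uniformity one less. A link edge is left out once it contains a
  set whose degree in \<open>G\<close> has reached the cap \<open>c\<close>, so a degree exceeds its cap by at most the
  contribution \<open>D\<close> of a single vertex. Since \<open>c i \<le> 1\<close>, edges of \<open>G\<close> are themselves saturated and
  are never added twice.\<close>

locale container_level =
  fixes V :: "'a set" and H :: "'a set set" and i :: nat and c D :: "nat \<Rightarrow> real" and \<theta> :: real
  assumes finV: "finite V" and i1: "1 \<le> i"
    and unif: "\<And>h. h \<in> H \<Longrightarrow> h \<subseteq> V \<and> card h = Suc i"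
    and deg_le: "\<And>S. S \<noteq> {} \<Longrightarrow> card S \<le> Suc i \<Longrightarrow> real (deg H S) \<le> D (card S)"
    and D0: "\<And>j. 0 \<le> D j" and c0: "\<And>j. 0 < c j" and ci: "c i \<le> 1" and \<theta>0: "0 < \<theta>"
begin

definition saturated :: "'a set set \<Rightarrow> 'a set set" where
  "saturated G = {S. S \<subseteq> V \<and> S \<noteq> {} \<and> card S \<le> i \<and> c (card S) \<le> real (deg G S)}"

definition free_link :: "'a set set \<Rightarrow> 'a \<Rightarrow> 'a set set" where
  "free_link G x = {e. x \<notin> e \<and> insert x e \<in> H \<and> (\<forall>S\<in>saturated G. \<not> S \<subseteq> e)}"

inductive builds :: "'a set \<Rightarrow> 'a set set \<Rightarrow> bool" where
  empty: "builds {} {}"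
| insert: "builds F G \<Longrightarrow> x \<notin> F \<Longrightarrow> \<theta> \<le> real (card (free_link G x)) \<Longrightarrow>
    builds (insert x F) (G \<union> free_link G x)"

section \<open>Hypergraphs built from links of fingerprint vertices\<close>

lemma finH: "finite H"
  by (rule finite_subset[of _ "Pow V"]) (use unif finV in auto)

lemma free_link_sub: "free_link G x \<subseteq> {e. e \<subseteq> V \<and> card e = i}"
proof
  fix e assume "e \<in> free_link G x"
  then have e: "x \<notin> e" "insert x e \<in> H" by (auto simp: free_link_def)
  from unif[OF e(2)] have "insert x e \<subseteq> V" "card (insert x e) = Suc i" by auto
  moreover have "finite e" by (rule finite_subset[OF _ finV]) (use \<open>insert x e \<subseteq> V\<close> in auto)
  ultimately show "e \<in> {e. e \<subseteq> V \<and> card e = i}" using e by auto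
qed

lemma fin_free_link: "finite (free_link G x)"
  by (rule finite_subset[OF free_link_sub]) (use finV in auto)

lemma builds_finite: "builds F G \<Longrightarrow> finite F"
  by (induction rule: builds.induct) auto

lemma builds_sub: "builds F G \<Longrightarrow> G \<subseteq> {e. e \<subseteq> V \<and> card e = i}"
  by (induction rule: builds.induct) (use free_link_sub in auto)

lemma builds_finite_edges: "builds F G \<Longrightarrow> finite G"
  by (rule finite_subset[OF builds_sub]) (use finV in auto)

lemma builds_extends: "builds F G \<Longrightarrow> e \<in> G \<Longrightarrow> \<exists>x\<in>F. insert x e \<in> H"
  by (induction rule: builds.induct) (auto simp: free_link_def)

text \<open>An edge of \<open>G\<close> inside \<open>I\<close> would, together with some vertex of
  \<open>F \<subseteq> I\<close>, form an edge of \<open>H\<close> inside \<open>I\<close>.\<close>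

lemma builds_indep:
  assumes "builds F G" "F \<subseteq> I" "I \<in> indep_sets V H"
  shows "I \<in> indep_sets V G"
proof -
  have "\<not> e \<subseteq> I" if "e \<in> G" for e
  proof -
    from builds_extends[OF assms(1) that] obtain x where "x \<in> F" "insert x e \<in> H" by auto
    then show ?thesis using assms(2,3) by (auto simp: indep_sets_def)
  qed
  then show ?thesis using assms(3) by (auto simp: indep_sets_def)
qed

lemma in_saturated:
  assumes "finite G" "G \<subseteq> {e. e \<subseteq> V \<and> card e = i}" "e \<in> G"
  shows "e \<in> saturated G"
proof -
  have e: "e \<subseteq> V" "card e = i" using assms by auto
  have "{h\<in>G. e \<subseteq> h} \<noteq> {}" using assms by auto
  then have "0 < deg G e" unfolding deg_def using assms(1) by (simp add: card_gt_0_iff)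
  then show ?thesis using e i1 ci unfolding saturated_def by auto
qed

lemma free_link_disjoint:
  assumes "builds F G" shows "G \<inter> free_link G x = {}"
  using in_saturated[OF builds_finite_edges[OF assms] builds_sub[OF assms]]
  unfolding free_link_def by auto

text \<open>Every insertion contributes at least \<theta> edges, all of them new by
  \<open>free_link_disjoint\<close>. Together with an upper bound on \<open>card G\<close> this
  limits the size of a fingerprint.\<close>

lemma builds_card: "builds F G \<Longrightarrow> \<theta> * real (card F) \<le> real (card G)"
proof (induction rule: builds.induct)
  case (insert F G x)
  have "card (G \<union> free_link G x) = card G + card (free_link G x)"
    by (rule card_Un_disjoint) (use insert builds_finite_edges fin_free_link free_link_disjoint in auto)
  moreover have "card (insert x F) = Suc (card F)"
    using insert builds_finite by auto
  ultimately show ?case using insert.IH insert.hyps by (simp add: algebra_simps)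
qed auto

lemma card_free_link_le:
  assumes "x \<notin> S"
  shows "card {e \<in> free_link G x. S \<subseteq> e} \<le> deg H (insert x S)"
  unfolding deg_def
proof (rule card_inj_on_le[of "insert x"])
  show "inj_on (insert x) {e \<in> free_link G x. S \<subseteq> e}"
    by (rule inj_onI) (auto simp: free_link_def)
qed (use finH in \<open>auto simp: free_link_def\<close>)

lemma builds_deg:
  assumes "builds F G" "S \<noteq> {}" "card S \<le> i"
  shows "real (deg G S) \<le> c (card S) + D (Suc (card S))"
  using assms
proof (induction rule: builds.induct)
  case empty
  show ?case using c0 D0 by (simp add: deg_def add_nonneg_nonneg less_imp_le)
next
  case (insert F G x)
  have fin: "finite G" using insert builds_finite_edges by auto
  have *: "{h \<in> G \<union> free_link G x. S \<subseteq> h} = {h \<in> G. S \<subseteq> h} \<union> {h \<in> free_link G x. S \<subseteq> h}" by auto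
  show ?case
  \<comment> \<open>In the first case no added edge contains \<open>S\<close>. Otherwise
    \<open>S\<close> is still below its cap, and an added edge \<open>e\<close> containing
    \<open>S\<close> gives the edge \<open>insert x e\<close> of \<open>H\<close> containing
    \<open>insert x S\<close>.\<close>
  proof (cases "S \<in> saturated G \<or> x \<in> S \<or> \<not> S \<subseteq> V")
    case True
    then have "{h \<in> free_link G x. S \<subseteq> h} = {}"
    proof (elim disjE)
      assume "\<not> S \<subseteq> V"
      then show ?thesis using free_link_sub[of G x] by fastforce
    qed (auto simp: free_link_def)
    then have "deg (G \<union> free_link G x) S = deg G S"
      unfolding deg_def * by (simp only: Un_empty_right)
    then show ?thesis using insert by simp
  next
    case False
    then have "real (deg G S) < c (card S)" using insert.prems by (auto simp: saturated_def not_le)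
    moreover have "card {h \<in> free_link G x. S \<subseteq> h} \<le> deg H (insert x S)"
      using False card_free_link_le by auto
    moreover have "real (deg H (insert x S)) \<le> D (Suc (card S))"
    proof -
      have "finite S" by (rule finite_subset[OF _ finV]) (use False in auto)
      then show ?thesis using deg_le[of "insert x S"] False insert.prems by auto
    qed
    moreover have "deg (G \<union> free_link G x) S \<le> deg G S + card {h \<in> free_link G x. S \<subseteq> h}"
      unfolding deg_def * by (rule card_Un_le)
    ultimately show ?thesis by linarith
  qed
qed

text \<open>Different orders of inserting the same vertices may build different hypergraphs. Fixing one of
  them for each set \<open>F\<close> keeps fingerprints unordered; counting ordered fingerprints would cost a
  logarithmic factor in the threshold.\<close>

definition built :: "'a set \<Rightarrow> 'a set set" where
  "built F = (SOME G. builds F G)"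

lemma builds_built: "builds F G \<Longrightarrow> builds F (built F)"
  unfolding built_def by (rule someI)

definition useful :: "'a set set \<Rightarrow> 'a set" where
  "useful G = {x \<in> V. \<theta> \<le> real (card (free_link G x))}"

text \<open>Take \<open>F\<close> maximal among the subsets of \<open>I\<close> from which something
  can be built. A vertex of \<open>I - F\<close> that is useful for \<open>built F\<close> could be
  inserted, contradicting maximality.\<close>

lemma ex_fingerprint:
  assumes "I \<in> indep_sets V H"
  obtains F where "F \<subseteq> I" "builds F (built F)" "I \<subseteq> F \<union> (V - useful (built F))"
proof -
  have IV: "I \<subseteq> V" using assms by (auto simp: indep_sets_def)
  define \<F> where "\<F> = {F. F \<subseteq> I \<and> (\<exists>G. builds F G)}"
  have "finite \<F>" by (rule finite_subset[of _ "Pow V"]) (use IV finV in \<open>auto simp: \<F>_def\<close>)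
  moreover have "{} \<in> \<F>" using builds.empty by (auto simp: \<F>_def)
  ultimately obtain F where F: "F \<in> \<F>" "\<And>F'. F' \<in> \<F> \<Longrightarrow> F \<subseteq> F' \<Longrightarrow> F = F'"
    using finite_has_maximal2[of \<F> "{}"] by metis
  from F(1) have F1: "F \<subseteq> I" "builds F (built F)" using builds_built by (auto simp: \<F>_def)
  have "x \<notin> useful (built F)" if "x \<in> I" "x \<notin> F" for x
  proof
    assume "x \<in> useful (built F)"
    then have "builds (insert x F) (built F \<union> free_link (built F) x)"
      using builds.insert F1 that by (auto simp: useful_def)
    then have "insert x F \<in> \<F>" using that F1 by (auto simp: \<F>_def)
    then show False using F(2)[of "insert x F"] that by auto
  qed
  then have "I \<subseteq> F \<union> (V - useful (built F))" using IV by auto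
  then show thesis using that F1 by simp
qed

text \<open>Double counting of pairs \<open>S \<subseteq> h\<close> with
  \<open>h \<in> G\<close>.\<close>

lemma sum_deg_Pow:
  assumes "finite G" "G \<subseteq> {e. e \<subseteq> V \<and> card e = i}"
  shows "(\<Sum>S\<in>Pow V. deg G S) = 2 ^ i * card G"
proof -
  have "(\<Sum>S\<in>Pow V. deg G S) = (\<Sum>S\<in>Pow V. \<Sum>h\<in>G. if S \<subseteq> h then 1 else 0)"
    unfolding deg_def using assms(1) by (intro sum.cong refl) (simp add: sum.If_cases Int_def)
  also have "\<dots> = (\<Sum>h\<in>G. \<Sum>S\<in>Pow V. if S \<subseteq> h then 1 else 0)" by (rule sum.swap)
  also have "\<dots> = (\<Sum>h\<in>G. 2 ^ i)"
  proof (intro sum.cong refl)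
    fix h assume "h \<in> G"
    then have h: "h \<subseteq> V" "card h = i" using assms by auto
    then have "{S \<in> Pow V. S \<subseteq> h} = Pow h" by auto
    moreover have "finite h" by (rule finite_subset[OF h(1) finV])
    ultimately have "card {S \<in> Pow V. S \<subseteq> h} = 2 ^ i" using h card_Pow by metis
    then show "(\<Sum>S\<in>Pow V. if S \<subseteq> h then 1 else 0) = (2::nat) ^ i"
      using finV by (simp add: sum.If_cases Int_def)
  qed
  finally show ?thesis by simp
qed

text \<open>An edge of \<open>H\<close> either contains a saturated set or is a vertex
  \<open>x\<close> joined to an edge of its free link. For saturated \<open>S\<close>,
  \<open>deg H S\<close> is at most \<open>q * deg G S\<close>, and summing over all
  \<open>S\<close> gives the first term. A free link has fewer than \<theta> edges unless
  \<open>x\<close> is useful, when it has at most \<open>D 1\<close>.\<close>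

lemma card_edges_le:
  assumes G: "finite G" "G \<subseteq> {e. e \<subseteq> V \<and> card e = i}"
    and q: "\<And>j. D j \<le> q * c j"
  shows "real (card H) \<le> q * 2 ^ i * real (card G) + \<theta> * real (card V) + real (card (useful G)) * D 1"
proof -
  have q0: "0 \<le> q" using q[of 0] c0[of 0] D0[of 0]
    by (meson dual_order.trans linorder_not_le mult_neg_pos)
  have finS: "finite (saturated G)"
    by (rule finite_subset[of _ "Pow V"]) (use finV in \<open>auto simp: saturated_def\<close>)
  have sub: "H \<subseteq> (\<Union>S\<in>saturated G. {h\<in>H. S \<subseteq> h}) \<union> (\<Union>x\<in>V. insert x ` free_link G x)"
  proof
    fix h assume h: "h \<in> H"
    show "h \<in> (\<Union>S\<in>saturated G. {h\<in>H. S \<subseteq> h}) \<union> (\<Union>x\<in>V. insert x ` free_link G x)"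
    proof (cases "\<exists>S\<in>saturated G. S \<subseteq> h")
      case False
      obtain x where x: "x \<in> h" using unif[OF h] by fastforce
      then have "insert x (h - {x}) = h" by auto
      moreover from this have "h - {x} \<in> free_link G x" using False h by (auto simp: free_link_def)
      ultimately have "h \<in> insert x ` free_link G x" by (metis imageI)
      then show ?thesis using x unif[OF h] by auto
    qed (use h in auto)
  qed
  have "card H \<le> card (\<Union>S\<in>saturated G. {h\<in>H. S \<subseteq> h}) + card (\<Union>x\<in>V. insert x ` free_link G x)"
    by (rule order_trans[OF card_mono[OF _ sub] card_Un_le])
      (use finS finV finH fin_free_link in auto)
  also have "card (\<Union>S\<in>saturated G. {h\<in>H. S \<subseteq> h}) \<le> (\<Sum>S\<in>saturated G. deg H S)"
    unfolding deg_def by (rule card_UN_le[OF finS])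
  also have "card (\<Union>x\<in>V. insert x ` free_link G x) \<le> (\<Sum>x\<in>V. card (free_link G x))"
    by (rule order_trans[OF card_UN_le[OF finV] sum_mono]) (rule card_image_le[OF fin_free_link])
  finally have 1: "real (card H) \<le> (\<Sum>S\<in>saturated G. real (deg H S)) + (\<Sum>x\<in>V. real (card (free_link G x)))"
    by (simp flip: of_nat_sum of_nat_add)
  have "(\<Sum>S\<in>saturated G. real (deg H S)) \<le> (\<Sum>S\<in>saturated G. q * real (deg G S))"
  proof (rule sum_mono)
    fix S assume "S \<in> saturated G"
    then have S: "S \<noteq> {}" "card S \<le> i" "c (card S) \<le> real (deg G S)" by (auto simp: saturated_def)
    have "real (deg H S) \<le> q * c (card S)" using deg_le[of S] S q[of "card S"] by auto
    also have "\<dots> \<le> q * real (deg G S)" using S q0 by (intro mult_left_mono) auto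
    finally show "real (deg H S) \<le> q * real (deg G S)" .
  qed
  also have "\<dots> \<le> (\<Sum>S\<in>Pow V. q * real (deg G S))"
    by (rule sum_mono2) (use finV q0 in \<open>auto simp: saturated_def\<close>)
  also have "\<dots> = q * 2 ^ i * real (card G)"
    using sum_deg_Pow[OF G] by (simp flip: sum_distrib_left of_nat_sum)
  finally have 2: "(\<Sum>S\<in>saturated G. real (deg H S)) \<le> q * 2 ^ i * real (card G)" .
  have "(\<Sum>x\<in>V. real (card (free_link G x))) \<le> (\<Sum>x\<in>V. \<theta> + (if x \<in> useful G then D 1 else 0))"
  proof (rule sum_mono)
    fix x assume x: "x \<in> V"
    have "card (free_link G x) \<le> deg H {x}" using card_free_link_le[of x "{}" G] by simp
    moreover have "real (deg H {x}) \<le> D 1" using deg_le[of "{x}"] by simp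
    ultimately show "real (card (free_link G x)) \<le> \<theta> + (if x \<in> useful G then D 1 else 0)"
      using x \<theta>0 by (auto simp: useful_def)
  qed
  also have "\<dots> = \<theta> * real (card V) + real (card (useful G)) * D 1"
    using finV by (simp add: sum.distrib sum.If_cases Int_def useful_def)
  finally show ?thesis using 1 2 by linarith
qed

text \<open>Edges of \<open>G\<close> are nonempty because \<open>1 \<le> i\<close>, so
  \<open>card G\<close> is at most the sum of the vertex degrees, which \<open>builds_deg\<close>
  bounds.\<close>

lemma builds_card_le:
  assumes "builds F G"
  shows "real (card G) \<le> real (card V) * (c 1 + D 2)"
proof -
  have sub: "G \<subseteq> (\<Union>x\<in>V. {h\<in>G. {x} \<subseteq> h})"
  proof
    fix e assume e: "e \<in> G"
    then have "e \<subseteq> V" "card e = i" using builds_sub[OF assms] by auto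
    moreover from this obtain x where "x \<in> e" using i1 by fastforce
    ultimately show "e \<in> (\<Union>x\<in>V. {h\<in>G. {x} \<subseteq> h})" using e by auto
  qed
  have "card G \<le> (\<Sum>x\<in>V. deg G {x})"
    unfolding deg_def
    by (rule order_trans[OF card_mono[OF _ sub] card_UN_le[OF finV]])
      (use finV builds_finite_edges[OF assms] in auto)
  then have "real (card G) \<le> (\<Sum>x\<in>V. real (deg G {x}))" by (simp flip: of_nat_sum)
  also have "\<dots> \<le> (\<Sum>x\<in>V. c 1 + D 2)"
    by (rule sum_mono) (use builds_deg[OF assms, of "{_}"] i1 in \<open>auto simp: numeral_2_eq_2\<close>)
  finally show ?thesis by simp
qed

end

text \<open>Here \<open>A\<close> is the scale of the vertex degrees and \<tau> the factor lost per
  further vertex, as well as the density of fingerprints. The normalisation makes the bound for a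
  full edge equal to \<beta>. \<open>N\<close> only bounds \<open>card V\<close>, so it can stay
  fixed while \<open>V\<close> shrinks.\<close>

definition bounded_codegrees ::
  "'a set \<Rightarrow> 'a set set \<Rightarrow> nat \<Rightarrow> real \<Rightarrow> real \<Rightarrow> real \<Rightarrow> real \<Rightarrow> bool" where
  "bounded_codegrees V H i N \<tau> A \<beta> \<longleftrightarrow>
     finite V \<and> real (card V) \<le> N \<and> 0 < \<tau> \<and> 0 < A \<and> A * \<tau> ^ (i - 1) = 1 \<and>
     (\<forall>h\<in>H. h \<subseteq> V \<and> card h = i) \<and>
     (\<forall>S. S \<noteq> {} \<longrightarrow> card S \<le> i \<longrightarrow> real (deg H S) \<le> \<beta> * A * \<tau> ^ (card S - 1))"

text \<open>If the hypergraph built from the fingerprint is dense, the induction continues with it. Otherwise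
  few edges of \<open>H\<close> contain a saturated set, so a positive proportion of the vertices is useful, and by
  maximality of the fingerprint none of them lies in \<open>I\<close> outside \<open>F\<close>.\<close>

lemma container_step:
  assumes "1 \<le> i" and "0 < \<alpha>" and "0 < \<beta>"
  shows "\<exists>\<delta>>0. \<exists>K>0. \<exists>\<tau>\<^sub>0>0. \<forall>(V::'a set) H N \<tau> A.
    bounded_codegrees V H i N \<tau> A \<beta> \<longrightarrow> \<tau> \<le> \<tau>\<^sub>0 \<longrightarrow> \<alpha> * A * N \<le> real (card H) \<longrightarrow>
    has_containers (K * \<tau> * N) (i - 1) (indep_sets V H)
      (\<lambda>C. C \<subseteq> V \<and> real (card C) \<le> real (card V) - \<delta> * N)"
  using assms
proof (induction i arbitrary: \<alpha> \<beta> rule: nat_induct_at_least)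
  case base
  show ?case
  proof (rule exI[of _ \<alpha>], rule conjI, fact base, rule exI[of _ 1], rule conjI, rule zero_less_one,
      rule exI[of _ 1], rule conjI, rule zero_less_one, intro allI impI)
    fix V :: "'a set" and H N \<tau> A
    assume bc: "bounded_codegrees V H 1 N \<tau> A \<beta>" and cH: "\<alpha> * A * N \<le> real (card H)"
    from bc have V: "finite V" "real (card V) \<le> N" "(0::real) < \<tau>" "A * \<tau> ^ (1 - 1) = 1"
      and "\<forall>h\<in>H. h \<subseteq> V \<and> card h = 1" by (simp_all add: bounded_codegrees_def)
    note H = this(5) cH
    \<comment> \<open>For uniformity one, edges are vertices that no independent set may use, so
      \<open>V - \<Union>H\<close> contains all independent sets and no fingerprint is required. The
      normalisation reads \<open>A = 1\<close>.\<close>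
    have HU: "H = (\<lambda>x. {x}) ` \<Union>H"
      using H(1) by (auto simp: card_1_singleton_iff image_iff) (metis singletonI)
    have "card H \<le> card (\<Union>H)"
    proof -
      have "finite (\<Union>H)" by (rule finite_subset[OF _ V(1)]) (use H in auto)
      then show ?thesis by (subst HU) (rule card_image_le)
    qed
    moreover have "card (V - \<Union>H) = card V - card (\<Union>H)" "card (\<Union>H) \<le> card V"
      using H(1) V(1) by (auto intro!: card_Diff_subset card_mono finite_subset[OF _ V(1)])
    ultimately have "real (card (V - \<Union>H)) \<le> real (card V) - \<alpha> * N"
      using H(2) V(4) by simp
    moreover have "I \<subseteq> V - \<Union>H" if "I \<in> indep_sets V H" for I
    proof -
      have "x \<notin> I" if "x \<in> \<Union>H" for x
      proof -
        have "{x} \<in> H" using that by (subst HU) (rule imageI)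
        then show ?thesis using \<open>I \<in> indep_sets V H\<close> by (auto simp: indep_sets_def)
      qed
      then show ?thesis using that by (auto simp: indep_sets_def)
    qed
    ultimately show "has_containers (1 * \<tau> * N) (1 - 1) (indep_sets V H)
      (\<lambda>C. C \<subseteq> V \<and> real (card C) \<le> real (card V) - \<alpha> * N)"
      using V by (intro has_containers_const[of _ "V - \<Union>H"]) auto
  qed
next
  case (Suc i)
  note \<alpha> = \<open>0 < \<alpha>\<close> and \<beta> = \<open>0 < \<beta>\<close>
  \<comment> \<open>With fewer than \<open>\<alpha>' * (A * \<tau>) * N\<close> edges in
    \<open>G\<close>, the saturated sets account for at most a quarter of
    \<open>\<alpha> * A * N\<close> in \<open>card_edges_le\<close>.\<close>
  define \<alpha>' where "\<alpha>' = \<alpha> / (2 ^ i * 4 * \<beta>)"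
  have \<alpha>': "0 < \<alpha>'" using \<alpha> \<beta> by (simp add: \<alpha>'_def)
  obtain \<delta>' K' \<tau>' where pos: "0 < \<delta>'" "0 < K'" "0 < \<tau>'" and IH: "\<And>(V::'a set) H N \<tau> A.
      bounded_codegrees V H i N \<tau> A (1 + \<beta>) \<Longrightarrow> \<tau> \<le> \<tau>' \<Longrightarrow> \<alpha>' * A * N \<le> real (card H) \<Longrightarrow>
      has_containers (K' * \<tau> * N) (i - 1) (indep_sets V H)
        (\<lambda>C. C \<subseteq> V \<and> real (card C) \<le> real (card V) - \<delta>' * N)"
    using Suc.IH[OF \<alpha>', of "1 + \<beta>"] \<beta> by (auto simp: add_pos_pos)
  \<comment> \<open>Comes from \<open>\<theta> * card F \<le> card G \<le> N * (1 + \<beta>) * A *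
    \<tau>\<close> with \<open>\<theta> = \<alpha> * A / 4\<close>.\<close>
  define K1 where "K1 = 4 * (1 + \<beta>) / \<alpha>"
  \<comment> \<open>In the sparse case at least \<open>2 * \<delta>1 * N\<close> vertices are
    useful. The bound \<open>\<tau> \<le> \<delta>1 / K1\<close> keeps \<open>card F\<close> below
    \<open>\<delta>1 * N\<close>, so the container still loses \<open>\<delta>1 * N\<close>
    vertices.\<close>
  define \<delta>1 where "\<delta>1 = \<alpha> / (4 * \<beta>)"
  have pos1: "0 < K1" "0 < \<delta>1" using \<alpha> \<beta> by (auto simp: K1_def \<delta>1_def)
  have pos2: "0 < min \<delta>' \<delta>1" "0 < max K' K1" "0 < min \<tau>' (\<delta>1 / K1)" using pos pos1 by auto
  show ?case
  proof (rule exI[of _ "min \<delta>' \<delta>1"], rule conjI, fact pos2, rule exI[of _ "max K' K1"], rule conjI, fact pos2,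
      rule exI[of _ "min \<tau>' (\<delta>1 / K1)"], rule conjI, fact pos2, intro allI impI)
    fix V :: "'a set" and H N \<tau> A
    assume bc: "bounded_codegrees V H (Suc i) N \<tau> A \<beta>"
      and \<tau>\<^sub>0: "\<tau> \<le> min \<tau>' (\<delta>1 / K1)" and cH: "\<alpha> * A * N \<le> real (card H)"
    from bc have V: "finite V" "real (card V) \<le> N" and "(0::real) < \<tau>"
      and A: "0 < A" "A * \<tau> ^ (Suc i - 1) = 1" and "\<forall>h\<in>H. h \<subseteq> V \<and> card h = Suc i"
      unfolding bounded_codegrees_def by blast+
    note \<tau> = this(3) \<tau>\<^sub>0 and H = this(6) cH
    from bc have dH: "\<forall>S. S \<noteq> {} \<longrightarrow> card S \<le> Suc i \<longrightarrow> real (deg H S) \<le> \<beta> * A * \<tau> ^ (card S - 1)"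
      unfolding bounded_codegrees_def by blast
    have N: "0 \<le> N" using V(2) of_nat_0_le_iff order_trans by blast
    define \<theta> where "\<theta> = \<alpha> * A / 4"
    \<comment> \<open>The caps are the codegree scale of the next level, where
      \<open>A * \<tau>\<close> replaces \<open>A\<close>; in particular \<open>c i = 1\<close>. The
      overshoot \<open>D (Suc j)\<close> is \<open>\<beta> * c j\<close>, hence the new constant
      \<open>1 + \<beta>\<close>.\<close>
    define c where "c = (\<lambda>j. A * \<tau> ^ j)"
    define D where "D = (\<lambda>j. if j = 0 then 0 else \<beta> * A * \<tau> ^ (j - 1))"
    interpret container_level V H i c D \<theta>
    proof
      show "real (deg H S) \<le> D (card S)" if "S \<noteq> {}" "card S \<le> Suc i" for S
      \<comment> \<open>An infinite \<open>S\<close> has \<open>card S = 0\<close> and so passes the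
        cardinality test, but no edge contains it.\<close>
      proof (cases "finite S")
        case True
        then show ?thesis using dH that by (simp add: D_def)
      next
        case False
        then have "{h \<in> H. S \<subseteq> h} = {}"
          using H(1) V(1) by (auto dest: finite_subset)
        then have "deg H S = 0" unfolding deg_def by (simp only: card.empty)
        then show ?thesis by (simp add: D_def \<beta> A \<tau> less_imp_le)
      qed
    qed (use V H A \<tau> \<alpha> \<beta> Suc.hyps in \<open>auto simp: D_def c_def \<theta>_def less_imp_le\<close>)
    have Aq: "c 1 + D 2 = (1 + \<beta>) * A * \<tau>" by (simp add: c_def D_def algebra_simps)
    let ?Q = "\<lambda>C. C \<subseteq> V \<and> real (card C) \<le> real (card V) - min \<delta>' \<delta>1 * N"
    \<comment> \<open>The independent sets for which \<open>F\<close> can serve as first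
      fingerprint. All of them are treated with the same hypergraph \<open>built F\<close>.\<close>
    define \<J> where "\<J> F = {I \<in> indep_sets V H. F \<subseteq> I \<and> builds F (built F) \<and>
        I \<subseteq> F \<union> (V - useful (built F))}" for F
    have cardF: "real (card F) \<le> K1 * \<tau> * N" if "builds F G" for F G
    proof -
      have "\<theta> * real (card F) \<le> real (card V) * ((1 + \<beta>) * A * \<tau>)"
        using builds_card[OF that] builds_card_le[OF that] Aq by simp
      also have "\<dots> \<le> N * ((1 + \<beta>) * A * \<tau>)"
        using V(2) \<beta> A \<tau> by (intro mult_right_mono) auto
      finally have "A * (\<alpha> * real (card F)) \<le> A * (4 * (1 + \<beta>) * \<tau> * N)"
        by (simp add: \<theta>_def algebra_simps)
      then have "\<alpha> * real (card F) \<le> 4 * (1 + \<beta>) * \<tau> * N" using A(1) by (rule mult_left_le_imp_le)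
      then show ?thesis using \<alpha> by (simp add: K1_def field_simps)
    qed
    have "has_containers (max K' K1 * \<tau> * N) (Suc (i - 1)) (indep_sets V H) ?Q"
    proof (rule has_containers_Suc)
      fix I assume I: "I \<in> indep_sets V H"
      from ex_fingerprint[OF I] obtain F where F: "F \<subseteq> I" "builds F (built F)"
        "I \<subseteq> F \<union> (V - useful (built F))" .
      have "K1 * \<tau> * N \<le> max K' K1 * \<tau> * N"
        using N \<tau> by (intro mult_right_mono) auto
      with cardF[OF F(2)] have "real (card F) \<le> max K' K1 * \<tau> * N" by linarith
      then show "\<exists>F. F \<subseteq> I \<and> real (card F) \<le> max K' K1 * \<tau> * N \<and> I \<in> \<J> F"
        using F I by (auto simp: \<J>_def)
    next
      fix F
      show "has_containers (max K' K1 * \<tau> * N) (i - 1) (\<J> F) ?Q"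
      proof (cases "\<J> F = {}")
        case True
        then show ?thesis using N \<tau> pos
          by (intro has_containers_const[of _ "{}"]) (auto simp: max_def)
      next
        case False
        define G where "G = built F"
        from False have bF: "builds F G" and FV: "F \<subseteq> V"
          by (auto simp: \<J>_def G_def indep_sets_def)
        show ?thesis
        proof (cases "\<alpha>' * (A * \<tau>) * N \<le> real (card G)")
          case True
          have "has_containers (K' * \<tau> * N) (i - 1) (indep_sets V G)
              (\<lambda>C. C \<subseteq> V \<and> real (card C) \<le> real (card V) - \<delta>' * N)"
          proof (rule IH[OF _ _ True])
            have "A * \<tau> * \<tau> ^ (i - 1) = 1"
              using A Suc.hyps by (cases i) (auto simp: mult.assoc)
            moreover have "\<forall>h\<in>G. h \<subseteq> V \<and> card h = i" using builds_sub[OF bF] by auto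
            moreover have "\<forall>S. S \<noteq> {} \<longrightarrow> card S \<le> i \<longrightarrow> real (deg G S) \<le> (1 + \<beta>) * (A * \<tau>) * \<tau> ^ (card S - 1)"
            proof (intro allI impI)
              fix S :: "'a set" assume S: "S \<noteq> {}" "card S \<le> i"
              show "real (deg G S) \<le> (1 + \<beta>) * (A * \<tau>) * \<tau> ^ (card S - 1)"
              proof (cases "finite S")
                case True
                then obtain j where j: "card S = Suc j" using S(1) by (cases "card S") auto
                show ?thesis using builds_deg[OF bF S] by (simp add: c_def D_def j algebra_simps)
              next
                case False
                then have "{h \<in> G. S \<subseteq> h} = {}"
                  using builds_sub[OF bF] V(1) by (auto dest: finite_subset)
                then have "deg G S = 0" unfolding deg_def by (simp only: card.empty)
                then show ?thesis using \<beta> A \<tau> by simp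
              qed
            qed
            ultimately show "bounded_codegrees V G i N \<tau> (A * \<tau>) (1 + \<beta>)"
              unfolding bounded_codegrees_def using V A(1) \<tau>(1) by (intro conjI mult_pos_pos)
          qed (use \<tau> in auto)
          moreover have "K' * \<tau> * N \<le> max K' K1 * \<tau> * N"
            using N \<tau> by (intro mult_right_mono) auto
          moreover have "min \<delta>' \<delta>1 * N \<le> \<delta>' * N" using N by (intro mult_right_mono) auto
          ultimately have "has_containers (max K' K1 * \<tau> * N) (i - 1) (indep_sets V G) ?Q"
            by (elim has_containers_mono) auto
          moreover have "\<J> F \<subseteq> indep_sets V G"
            using builds_indep[OF bF] by (auto simp: \<J>_def)
          ultimately show ?thesis by (rule has_containers_subset)
        next
          case False
          have "D j \<le> \<beta> / \<tau> * c j" for j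
            using \<beta> \<tau> A by (cases j) (auto simp: D_def c_def)
          from card_edges_le[OF builds_finite_edges[OF bF] builds_sub[OF bF] this]
          have "real (card H) \<le> \<beta> / \<tau> * 2 ^ i * real (card G) + \<theta> * real (card V)
              + real (card (useful G)) * (\<beta> * A)" by (simp add: D_def)
          moreover have "\<theta> * real (card V) \<le> \<theta> * N" using V \<theta>0 by (intro mult_left_mono) auto
          moreover have "\<beta> / \<tau> * 2 ^ i * real (card G) \<le> \<theta> * N"
          proof -
            have "\<beta> / \<tau> * 2 ^ i * real (card G) \<le> \<beta> / \<tau> * 2 ^ i * (\<alpha>' * (A * \<tau>) * N)"
              using False \<beta> \<tau> by (intro mult_left_mono) auto
            also have "\<dots> = \<theta> * N" using \<beta> \<tau> by (simp add: \<alpha>'_def \<theta>_def)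
            finally show ?thesis .
          qed
          ultimately have "\<alpha> * A * N \<le> 2 * (\<theta> * N) + real (card (useful G)) * (\<beta> * A)"
            using H(2) by linarith
          then have "A * (\<alpha> * N) \<le> A * (2 * \<beta> * real (card (useful G)))"
            by (simp add: \<theta>_def algebra_simps)
          then have "\<alpha> * N \<le> 2 * \<beta> * real (card (useful G))" using A(1) by (rule mult_left_le_imp_le)
          then have "2 * (\<delta>1 * N) \<le> real (card (useful G))"
            using \<beta> by (simp add: \<delta>1_def field_simps)
          moreover have "real (card F) \<le> \<delta>1 * N"
          proof -
            have "K1 * \<tau> \<le> \<delta>1" using \<tau> pos1 by (simp add: field_simps)
            then show ?thesis using cardF[OF bF] mult_right_mono[OF _ N] by fastforce
          qed
          moreover have "card (F \<union> (V - useful G)) \<le> card F + card (V - useful G)"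
            by (rule card_Un_le)
          moreover have "card (V - useful G) = card V - card (useful G)" "card (useful G) \<le> card V"
            using V(1) by (auto simp: useful_def intro!: card_Diff_subset card_mono)
          ultimately have "real (card (F \<union> (V - useful G))) \<le> real (card V) - \<delta>1 * N" by linarith
          moreover have "min \<delta>' \<delta>1 * N \<le> \<delta>1 * N" using N by (intro mult_right_mono) auto
          ultimately have "?Q (F \<union> (V - useful G))" using FV by auto
          then show ?thesis using N \<tau> pos
            by (intro has_containers_const[of _ "F \<union> (V - useful G)"])
              (auto simp: \<J>_def G_def max_def)
        qed
      qed
    qed
    then show "has_containers (max K' K1 * \<tau> * N) (Suc i - 1) (indep_sets V H) ?Q"
      using Suc.hyps by simp
  qed
qed

text \<open>\<open>container_step\<close> is iterated on the hypergraph induced by the current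
  container, as long as that has many edges. Codegrees do not grow under restriction, and
  \<open>N\<close>, \<open>A\<close>, \<tau> stay fixed, so each round removes another
  \<open>\<delta> * N\<close> vertices. After more than \<open>1 / \<delta>\<close> rounds only the
  sparse alternative is possible.\<close>

lemma hypergraph_containers:
  assumes "1 \<le> i" and "0 < \<alpha>" and "0 < \<beta>"
  shows "\<exists>m. \<exists>K>0. \<exists>\<tau>\<^sub>0>0. \<forall>(V::'a set) H N \<tau> A.
    bounded_codegrees V H i N \<tau> A \<beta> \<longrightarrow> 0 < N \<longrightarrow> \<tau> \<le> \<tau>\<^sub>0 \<longrightarrow>
    has_containers (K * \<tau> * N) m (indep_sets V H)
      (\<lambda>C. C \<subseteq> V \<and> real (card {h \<in> H. h \<subseteq> C}) < \<alpha> * A * N)"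
proof -
  from container_step[OF assms] obtain \<delta> K \<tau>0 where pos: "0 < \<delta>" "0 < K" "0 < \<tau>0"
    and step: "\<And>(V::'a set) H N \<tau> A.
    bounded_codegrees V H i N \<tau> A \<beta> \<Longrightarrow> \<tau> \<le> \<tau>0 \<Longrightarrow> \<alpha> * A * N \<le> real (card H) \<Longrightarrow>
    has_containers (K * \<tau> * N) (i - 1) (indep_sets V H)
      (\<lambda>C. C \<subseteq> V \<and> real (card C) \<le> real (card V) - \<delta> * N)"
    by blast
  from reals_Archimedean2[of "1 / \<delta>"] obtain j0 where j0: "1 / \<delta> < real j0" ..
  show ?thesis
  proof (rule exI[of _ "j0 * (i - 1)"], rule exI[of _ K], rule conjI, fact pos, rule exI[of _ \<tau>0],
      rule conjI, fact pos, intro allI impI)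
    fix V :: "'a set" and H N \<tau> A
    assume bc: "bounded_codegrees V H i N \<tau> A \<beta>" and N: "0 < N" and \<tau>0: "\<tau> \<le> \<tau>0"
    from bc have "finite V" "real (card V) \<le> N" and "(0::real) < \<tau>"
      and A: "0 < A" "A * \<tau> ^ (i - 1) = 1" and H: "\<forall>h\<in>H. h \<subseteq> V \<and> card h = i"
      unfolding bounded_codegrees_def by blast+
    note V = this(1,2) N and \<tau> = this(3) \<tau>0
    from bc have dH: "\<forall>S. S \<noteq> {} \<longrightarrow> card S \<le> i \<longrightarrow> real (deg H S) \<le> \<beta> * A * \<tau> ^ (card S - 1)"
      unfolding bounded_codegrees_def by blast
    have finH: "finite H" by (rule finite_subset[of _ "Pow V"]) (use H V in auto)
    let ?few = "\<lambda>C. real (card {h \<in> H. h \<subseteq> C}) < \<alpha> * A * N"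
    let ?R = "\<lambda>j C. C \<subseteq> V \<and> (?few C \<or> real (card C) \<le> real (card V) - real j * \<delta> * N)"
    have t0: "0 \<le> K * \<tau> * N" using pos \<tau> V by simp
    have "has_containers (K * \<tau> * N) (j * (i - 1)) (indep_sets V H) (?R j)" for j
    proof (induction j)
      case 0
      show ?case
        by (rule has_containers_const[of _ V]) (use t0 in \<open>auto simp: indep_sets_def\<close>)
    next
      case (Suc j)
      have "has_containers (K * \<tau> * N) (i - 1) {I \<in> indep_sets V H. I \<subseteq> C} (?R (Suc j))"
        if C: "?R j C" for C
      proof (cases "?few C")
        case True
        then show ?thesis by (intro has_containers_const[of _ C]) (use t0 C in auto)
      next
        case False
        let ?H = "{h \<in> H. h \<subseteq> C}"
        have finC: "finite C" by (rule finite_subset[OF _ V(1)]) (use C in auto)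
        have "card C \<le> card V" by (rule card_mono) (use C V in auto)
        have "has_containers (K * \<tau> * N) (i - 1) (indep_sets C ?H)
            (\<lambda>C'. C' \<subseteq> C \<and> real (card C') \<le> real (card C) - \<delta> * N)"
        proof (rule step)
          have "\<forall>S. S \<noteq> {} \<longrightarrow> card S \<le> i \<longrightarrow> real (deg ?H S) \<le> \<beta> * A * \<tau> ^ (card S - 1)"
          proof (intro allI impI)
            fix S :: "'a set" assume S: "S \<noteq> {}" "card S \<le> i"
            have "deg ?H S \<le> deg H S" unfolding deg_def by (rule card_mono) (use finH in auto)
            moreover have "real (deg H S) \<le> \<beta> * A * \<tau> ^ (card S - 1)" using dH S by auto
            ultimately show "real (deg ?H S) \<le> \<beta> * A * \<tau> ^ (card S - 1)" by linarith
          qed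
          moreover have "real (card C) \<le> N" using \<open>card C \<le> card V\<close> V(2) by linarith
          moreover have "\<forall>h\<in>?H. h \<subseteq> C \<and> card h = i" using H by auto
          ultimately show "bounded_codegrees C ?H i N \<tau> A \<beta>"
            unfolding bounded_codegrees_def using finC \<tau>(1) A by (intro conjI)
        qed (use \<tau>(2) False in auto)
        then have "has_containers (K * \<tau> * N) (i - 1) (indep_sets C ?H) (?R (Suc j))"
          by (rule has_containers_mono) (use C False in \<open>auto simp: algebra_simps\<close>)
        moreover have "{I \<in> indep_sets V H. I \<subseteq> C} \<subseteq> indep_sets C ?H"
          by (auto simp: indep_sets_def)
        ultimately show ?thesis by (rule has_containers_subset)
      qed
      from has_containers_trans[OF Suc.IH this] show ?case by (simp add: add.commute)
    qed
    then have "has_containers (K * \<tau> * N) (j0 * (i - 1)) (indep_sets V H) (?R j0)" .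
    moreover have "\<not> real (card C) \<le> real (card V) - real j0 * \<delta> * N" for C :: "'a set"
    proof -
      have "1 < real j0 * \<delta>" using j0 pos by (simp add: field_simps)
      then have "N < real j0 * \<delta> * N" using V by simp
      then show ?thesis using V(2) of_nat_0_le_iff[of "card C", where ?'a = real] by linarith
    qed
    ultimately show "has_containers (K * \<tau> * N) (j0 * (i - 1)) (indep_sets V H)
        (\<lambda>C. C \<subseteq> V \<and> ?few C)"
      by (elim has_containers_mono) auto
  qed
qed

section \<open>Cliques in dense graphs\<close>

definition pairs :: "'a set \<Rightarrow> 'a set set" where
  "pairs W = {e. e \<subseteq> W \<and> card e = 2}"

text \<open>A hypergraph on the vertex set \<open>pairs {..<n}\<close>: its edges are the edge sets
  of the copies of the complete graph on \<open>r\<close> vertices, and its independent sets are the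
  graphs without such a copy.\<close>

definition cliques :: "nat \<Rightarrow> nat \<Rightarrow> nat set set set" where
  "cliques r n = pairs ` {W. W \<subseteq> {..<n} \<and> card W = r}"

lemma card_pairs: "finite W \<Longrightarrow> card (pairs W) = card W choose 2"
  by (simp add: pairs_def n_subsets)

lemma finite_pairs: "finite W \<Longrightarrow> finite (pairs W)"
  by (rule finite_subset[of _ "Pow W"]) (auto simp: pairs_def)

lemma Union_pairs:
  assumes "card W \<ge> 2" shows "\<Union>(pairs W) = W"
proof
  show "W \<subseteq> \<Union>(pairs W)"
  proof
    fix x assume x: "x \<in> W"
    have "W \<noteq> {x}" using assms by auto
    then obtain y where "y \<in> W" "y \<noteq> x" using x by auto
    then have "{x, y} \<in> pairs W" using x by (auto simp: pairs_def)
    then show "x \<in> \<Union>(pairs W)" by auto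
  qed
qed (auto simp: pairs_def)

lemma binomial_le_power: "n choose r \<le> n ^ r"
  by (cases "r \<le> n") (auto simp: binomial_le_pow binomial_eq_0)

lemma card_supersets_le:
  assumes "finite U"
  shows "card {W. W \<subseteq> {..<n} \<and> card W = r \<and> U \<subseteq> W} \<le> n ^ (r - card U)"
proof -
  have "card {W. W \<subseteq> {..<n} \<and> card W = r \<and> U \<subseteq> W} \<le> card {W. W \<subseteq> {..<n} \<and> card W = r - card U}"
  proof (rule card_inj_on_le[of "\<lambda>W. W - U"])
    show "inj_on (\<lambda>W. W - U) {W. W \<subseteq> {..<n} \<and> card W = r \<and> U \<subseteq> W}"
      by (rule inj_onI) (auto; blast)
    show "(\<lambda>W. W - U) ` {W. W \<subseteq> {..<n} \<and> card W = r \<and> U \<subseteq> W} \<subseteq> {W. W \<subseteq> {..<n} \<and> card W = r - card U}"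
      using assms by (auto simp: card_Diff_subset)
  qed auto
  also have "\<dots> = n choose (r - card U)" by (simp add: n_subsets)
  finally show ?thesis using binomial_le_power order_trans by blast
qed

lemma finite_bounded_subsets: "finite {W. W \<subseteq> {..<n::nat} \<and> P W}"
  by (rule finite_subset[of _ "Pow {..<n}"]) auto

text \<open>If the pairs in \<open>S\<close> span \<open>v\<close> vertices, at most
  \<open>n ^ (r - v)\<close> cliques contain \<open>S\<close>, while
  \<open>card S \<le> v choose 2\<close>. The inequality for \<open>v\<close> turns this into the
  codegree bound with \<open>\<tau> = n powr - a\<close>; the equation for \<open>r\<close> is the
  normalisation.\<close>

lemma cliques_bounded_codegrees:
  assumes r: "2 \<le> r" and n: "1 \<le> n"
    and a: "a * (real (r choose 2) - 1) = real r - 2"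
    and av: "\<And>v. 2 \<le> v \<Longrightarrow> v \<le> r \<Longrightarrow> a * (real (v choose 2) - 1) \<le> real v - 2"
    and a0: "0 \<le> a"
  shows "bounded_codegrees (pairs {..<n}) (cliques r n) (r choose 2) (real n ^ 2)
    (real n powr - a) (real n ^ (r - 2)) 1"
proof -
  have n0: "0 < real n" using n by simp
  have pw: "real n ^ j = real n powr real j" for j using n0 by (simp add: powr_realpow)
  have \<tau>: "(real n powr - a) ^ j = real n powr (- a * real j)" for j
    using n0 by (simp add: powr_power mult.commute)
  have ch: "1 \<le> v choose 2" if "2 \<le> v" for v :: nat using that
    by (simp add: Suc_leI)
  have "real (card (pairs {..<n})) \<le> real n ^ 2"
    using binomial_le_power[of n 2] by (simp add: card_pairs flip: of_nat_power)
  moreover have "real n ^ (r - 2) * (real n powr - a) ^ ((r choose 2) - 1) = 1"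
    using r ch[OF r] a n0 by (simp add: pw \<tau> of_nat_diff flip: powr_add)
  moreover have "\<forall>h\<in>cliques r n. h \<subseteq> pairs {..<n} \<and> card h = r choose 2"
    by (auto simp: cliques_def card_pairs finite_subset[OF _ finite_lessThan]) (auto simp: pairs_def)
  moreover have "real (deg (cliques r n) S) \<le> 1 * real n ^ (r - 2) * (real n powr - a) ^ (card S - 1)"
    if S: "S \<noteq> {}" for S
  proof (cases "\<exists>W. W \<subseteq> {..<n} \<and> card W = r \<and> S \<subseteq> pairs W")
    case False
    then have "{h \<in> cliques r n. S \<subseteq> h} = {}" by (auto simp: cliques_def)
    then have "deg (cliques r n) S = 0" unfolding deg_def by (simp only: card.empty)
    then show ?thesis by simp
  next
    case True
    then obtain W where W: "W \<subseteq> {..<n}" "card W = r" "S \<subseteq> pairs W" by auto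
    have finW: "finite W" using W(1) finite_subset by auto
    define U where "U = \<Union>S"
    have UW: "U \<subseteq> W" using W(3) by (auto simp: U_def pairs_def)
    then have finU: "finite U" using finW finite_subset by auto
    have SU: "S \<subseteq> pairs U" using W(3) by (auto simp: U_def pairs_def)
    have vr: "card U \<le> r" using card_mono[OF finW UW] W(2) by simp
    have v2: "2 \<le> card U"
    proof -
      obtain e where "e \<in> S" using S by auto
      then have "e \<subseteq> U" "card e = 2" using SU by (auto simp: pairs_def)
      then show ?thesis using card_mono[OF finU] by metis
    qed
    have cS: "card S \<le> card U choose 2"
      using card_mono[OF finite_pairs[OF finU] SU] card_pairs[OF finU] by simp
    have finS: "finite S" using SU finite_pairs[OF finU] finite_subset by auto
    have "card {h \<in> cliques r n. S \<subseteq> h} \<le> card (pairs ` {W. W \<subseteq> {..<n} \<and> card W = r \<and> U \<subseteq> W})"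
    proof (rule card_mono)
      show "{h \<in> cliques r n. S \<subseteq> h} \<subseteq> pairs ` {W. W \<subseteq> {..<n} \<and> card W = r \<and> U \<subseteq> W}"
        by (auto simp: cliques_def U_def pairs_def intro!: imageI)
    qed (simp add: finite_bounded_subsets)
    also have "\<dots> \<le> card {W. W \<subseteq> {..<n} \<and> card W = r \<and> U \<subseteq> W}"
      by (rule card_image_le) (simp add: finite_bounded_subsets)
    also have "\<dots> \<le> n ^ (r - card U)" by (rule card_supersets_le[OF finU])
    finally have "real (deg (cliques r n) S) \<le> real n ^ (r - card U)"
      unfolding deg_def by (simp flip: of_nat_power)
    also have "\<dots> = real n powr (real r - real (card U))" using vr by (simp add: pw of_nat_diff)
    also have "\<dots> \<le> real n powr (real r - 2 + (- a * real (card S - 1)))"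
    proof (rule powr_mono)
      have "real (card S - 1) \<le> real (card U choose 2) - 1"
        using cS finS S by (simp add: of_nat_diff Suc_leI card_gt_0_iff)
      then have "a * real (card S - 1) \<le> a * (real (card U choose 2) - 1)"
        using a0 by (rule mult_left_mono)
      also have "\<dots> \<le> real (card U) - 2" by (rule av[OF v2 vr])
      finally show "real r - real (card U) \<le> real r - 2 + (- a * real (card S - 1))" by simp
    qed (use n in simp)
    also have "\<dots> = 1 * real n ^ (r - 2) * (real n powr - a) ^ (card S - 1)"
      unfolding powr_add using r by (simp add: pw \<tau> of_nat_diff)
    finally show ?thesis .
  qed
  ultimately show ?thesis
    unfolding bounded_codegrees_def using n0 by (auto simp: finite_pairs)
qed

section \<open>The maximum 2-density of complete graphs\<close>

lemma max_2_density_complete_graph: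
  assumes "3 \<le> r"
  shows "max_2_density (complete_graph r) = (real r + 1) / 2"
proof -
  let ?X = "{(real (card (edges J)) - 1) / (real (card (verts J)) - 2) | J.
      subhypergraph J (complete_graph r) \<and> card (verts J) \<ge> 3}"
  \<comment> \<open>Since \<open>(v choose 2) - 1 = (v - 2) * (v + 1) / 2\<close>, the ratio of a
    complete graph increases with \<open>v\<close>, so the whole graph attains the maximum.\<close>
  have ch: "(real (v choose 2) - 1) / (real v - 2) = (real v + 1) / 2" if "3 \<le> v" for v
  proof -
    have "real (v choose 2) = real v * (real v - 1) / 2"
      using that by (simp add: choose_two real_of_nat_div of_nat_diff)
    then show ?thesis using that by (simp add: field_simps)
  qed
  have K: "complete_graph r = ({..<r}, pairs {..<r})"
    by (simp add: complete_hypergraph_def pairs_def)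
  have "Max ?X = (real r + 1) / 2"
  proof (rule Max_eqI)
    have "?X \<subseteq> (\<lambda>J. (real (card (edges J)) - 1) / (real (card (verts J)) - 2)) `
        (Pow {..<r} \<times> Pow (pairs {..<r}))"
    proof
      fix y assume "y \<in> ?X"
      then obtain J where J: "y = (real (card (edges J)) - 1) / (real (card (verts J)) - 2)"
        "subhypergraph J (complete_graph r)" by auto
      then have "J \<in> Pow {..<r} \<times> Pow (pairs {..<r})" by (cases J) (simp add: subhypergraph_def K)
      then show "y \<in> (\<lambda>J. (real (card (edges J)) - 1) / (real (card (verts J)) - 2)) `
        (Pow {..<r} \<times> Pow (pairs {..<r}))" using J(1) by (rule rev_image_eqI)
    qed
    then show "finite ?X" by (rule finite_subset) (auto simp: finite_pairs)
  next
    fix y assume "y \<in> ?X"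
    then obtain J where J: "y = (real (card (edges J)) - 1) / (real (card (verts J)) - 2)"
      "subhypergraph J (complete_graph r)" "card (verts J) \<ge> 3" by auto
    then have V: "verts J \<subseteq> {..<r}" and E: "edges J \<subseteq> pairs (verts J)"
      by (auto simp: subhypergraph_def K pairs_def)
    have fin: "finite (verts J)" using V finite_subset by auto
    have "card (edges J) \<le> card (verts J) choose 2"
      using card_mono[OF finite_pairs[OF fin] E] card_pairs[OF fin] by simp
    then have "y \<le> (real (card (verts J) choose 2) - 1) / (real (card (verts J)) - 2)"
      unfolding J(1) using J(3) by (intro divide_right_mono) auto
    also have "\<dots> = (real (card (verts J)) + 1) / 2" by (rule ch[OF J(3)])
    also have "\<dots> \<le> (real r + 1) / 2" using card_mono[OF _ V] by simp
    finally show "y \<le> (real r + 1) / 2" .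
  next
    have "(real r + 1) / 2 = (real (card (pairs {..<r})) - 1) / (real (card {..<r}) - 2)"
      using ch[OF assms] by (simp add: card_pairs)
    moreover have "subhypergraph ({..<r}, pairs {..<r}) (complete_graph r)"
      by (auto simp: K subhypergraph_def pairs_def)
    ultimately show "(real r + 1) / 2 \<in> ?X"
      using assms
      by (intro CollectI exI[of _ "({..<r}, pairs {..<r})"] conjI) (simp_all only: fst_conv snd_conv card_lessThan)
  qed
  then show ?thesis using assms by (simp add: max_2_density_def K)
qed

text \<open>For \<open>r = 2\<close> the default density 1 gives \<open>a = 1\<close>, and both
  sides of the last two claims vanish. For larger \<open>r\<close>, \<open>a = 2 / (r + 1)\<close>
  and the claims reduce to \<open>v + 1 \<le> r + 1\<close>.\<close>

lemma inverse_max_2_density: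
  fixes a :: real
  assumes "2 \<le> r" and "a = 1 / max_2_density (complete_graph r)"
  shows "0 < a" "a \<le> 1" "a * (real (r choose 2) - 1) = real r - 2"
    "\<And>v. 2 \<le> v \<Longrightarrow> v \<le> r \<Longrightarrow> a * (real (v choose 2) - 1) \<le> real v - 2"
proof -
  have ch: "real (v choose 2) - 1 = (real v - 2) * (real v + 1) / 2" if "2 \<le> v" for v
    using that by (simp add: choose_two real_of_nat_div of_nat_diff field_simps)
  have a: "a = (if r = 2 then 1 else 2 / (real r + 1))"
  proof (cases "r = 2")
    case True
    then show ?thesis using assms(2) by (simp add: max_2_density_def complete_hypergraph_def)
  next
    case False
    then show ?thesis using assms max_2_density_complete_graph[of r] by simp
  qed
  show "0 < a" "a \<le> 1" using a assms by (auto simp: field_simps)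
  show "a * (real (r choose 2) - 1) = real r - 2"
  proof (cases "r = 2")
    case False
    have "real r + 1 \<noteq> 0" by linarith
    then show ?thesis using False unfolding ch[OF assms(1)] a by simp
  qed simp
  fix v :: nat assume v: "2 \<le> v" "v \<le> r"
  show "a * (real (v choose 2) - 1) \<le> real v - 2"
  proof (cases "r = 2")
    case False
    have "a * (real v + 1) / 2 \<le> 1" using v False by (simp add: a field_simps)
    then have "(real v - 2) * (a * (real v + 1) / 2) \<le> (real v - 2) * 1"
      using v by (intro mult_left_mono) auto
    then show ?thesis unfolding ch[OF v(1)] by (simp add: field_simps)
  qed (use v in auto)
qed

text \<open>The container theorem with \<open>N = n ^ 2\<close>, \<open>\<tau> = n powr - a\<close>
  and \<open>A = n ^ (r - 2)\<close>: fingerprints have size of order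
  \<open>\<tau> * N = n powr (2 - a)\<close>, and \<open>A * N = n ^ r\<close>. Since
  \<open>pairs\<close> is injective on \<open>r\<close>-sets, edges of the clique hypergraph can be
  counted by vertex sets.\<close>

lemma clique_free_containers:
  assumes r: "2 \<le> r" and "0 < \<alpha>" and a: "a = 1 / max_2_density (complete_graph r)"
  shows "\<exists>m. \<exists>K>0. \<forall>\<^sub>F n in sequentially.
    has_containers (K * real n powr (2 - a)) m (indep_sets (pairs {..<n}) (cliques r n))
      (\<lambda>C. real (card {W. W \<subseteq> {..<n} \<and> card W = r \<and> pairs W \<subseteq> C}) \<le> \<alpha> * real n ^ r)"
proof -
  note a' = inverse_max_2_density[OF r a]
  have ell: "1 \<le> r choose 2" using r by (simp add: Suc_leI)
  from hypergraph_containers[OF ell \<open>0 < \<alpha>\<close> zero_less_one]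
  obtain m K \<tau>0 where K: "0 < K" "0 < \<tau>0" and cont: "\<And>(V::nat set set) H N \<tau> A.
    bounded_codegrees V H (r choose 2) N \<tau> A 1 \<Longrightarrow> 0 < N \<Longrightarrow> \<tau> \<le> \<tau>0 \<Longrightarrow>
    has_containers (K * \<tau> * N) m (indep_sets V H)
      (\<lambda>C. C \<subseteq> V \<and> real (card {h \<in> H. h \<subseteq> C}) < \<alpha> * A * N)"
    by blast
  have "((\<lambda>n. real n powr - a) \<longlongrightarrow> 0) sequentially"
    by (intro tendsto_neg_powr filterlim_real_sequentially) (use a'(1) in simp)
  then have ev: "\<forall>\<^sub>F n in sequentially. real n powr - a < \<tau>0"
    using K(2) by (rule order_tendstoD)
  have "\<forall>\<^sub>F n in sequentially.
    has_containers (K * real n powr (2 - a)) m (indep_sets (pairs {..<n}) (cliques r n))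
      (\<lambda>C. real (card {W. W \<subseteq> {..<n} \<and> card W = r \<and> pairs W \<subseteq> C}) \<le> \<alpha> * real n ^ r)"
    using ev eventually_ge_at_top[of 1]
  proof eventually_elim
    case (elim n)
    have "has_containers (K * real n powr - a * real n ^ 2) m (indep_sets (pairs {..<n}) (cliques r n))
      (\<lambda>C. C \<subseteq> pairs {..<n} \<and> real (card {h \<in> cliques r n. h \<subseteq> C}) < \<alpha> * real n ^ (r - 2) * real n ^ 2)"
      using elim a' r by (intro cont cliques_bounded_codegrees) auto
    then show ?case
    proof (rule has_containers_mono)
      have "real n powr (2 - a) = real n powr - a * real n ^ 2"
        using elim(2) powr_add[of "real n" "- a" 2] by simp
      then show "K * real n powr - a * real n ^ 2 \<le> K * real n powr (2 - a)" by simp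
    next
      fix C assume C: "C \<subseteq> pairs {..<n} \<and> real (card {h \<in> cliques r n. h \<subseteq> C}) < \<alpha> * real n ^ (r - 2) * real n ^ 2"
      have "card {W. W \<subseteq> {..<n} \<and> card W = r \<and> pairs W \<subseteq> C} \<le> card {h \<in> cliques r n. h \<subseteq> C}"
      proof (rule card_inj_on_le[of pairs])
        show "inj_on pairs {W. W \<subseteq> {..<n} \<and> card W = r \<and> pairs W \<subseteq> C}"
          by (rule inj_on_inverseI[of _ Union]) (use r Union_pairs in auto)
        have "finite (cliques r n)" unfolding cliques_def by (intro finite_imageI finite_bounded_subsets)
        then show "finite {h \<in> cliques r n. h \<subseteq> C}" by simp
      qed (auto simp: cliques_def)
      moreover have "real n ^ (r - 2) * real n ^ 2 = real n ^ r"
        unfolding power_add[symmetric] le_add_diff_inverse2[OF r] ..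
      ultimately show "real (card {W. W \<subseteq> {..<n} \<and> card W = r \<and> pairs W \<subseteq> C}) \<le> \<alpha> * real n ^ r"
        using C by (simp add: mult.assoc)
    qed
  qed
  then show ?thesis using K(1) by blast
qed

text \<open>By Ramsey's theorem every \<open>R\<close>-set contains a clique of size
  \<open>r\<close> or an independent \<open>s\<close>-set. A fixed \<open>r\<close>-set or
  \<open>s\<close>-set lies in at most \<open>n ^ (R - r)\<close> or \<open>n ^ (R - s)\<close> of
  the \<open>R\<close>-sets. The few cliques cover at most half of the lower bound on the number of
  \<open>R\<close>-sets, so independent sets cover the rest.\<close>

lemma few_cliques_imp_many_indep:
  assumes "2 \<le> s" "2 \<le> r"
  shows "\<exists>c>0. \<forall>\<^sub>F n in sequentially. \<forall>E.
    real (card {W. W \<subseteq> {..<n} \<and> card W = r \<and> pairs W \<subseteq> E}) \<le> c * real n ^ r \<longrightarrow>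
    c * real n ^ s \<le> real (card {W. W \<subseteq> {..<n} \<and> card W = s \<and> pairs W \<inter> E = {}})"
proof -
  from ramsey2[of r s] obtain R0 where R0: "\<And>(V::nat set) E. finite V \<Longrightarrow> card V \<ge> R0 \<Longrightarrow>
      \<exists>W\<subseteq>V. card W = r \<and> clique W E \<or> card W = s \<and> indep W E" by auto
  \<comment> \<open>Being at least \<open>r\<close> and \<open>s\<close>, \<open>R\<close> makes the
    differences \<open>R - r\<close> and \<open>R - s\<close> genuine.\<close>
  define R where "R = max R0 (max r s)"
  \<comment> \<open>Chosen so that \<open>2 * c * n ^ R = (n / R) ^ R\<close>, a lower bound for
    \<open>n choose R\<close>.\<close>
  define c where "c = 1 / (2 * real R ^ R)"
  have Rpos: "0 < R" using assms by (simp add: R_def)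
  then have c: "0 < c" by (simp add: c_def)
  have "\<forall>\<^sub>F n in sequentially. \<forall>E.
    real (card {W. W \<subseteq> {..<n} \<and> card W = r \<and> pairs W \<subseteq> E}) \<le> c * real n ^ r \<longrightarrow>
    c * real n ^ s \<le> real (card {W. W \<subseteq> {..<n} \<and> card W = s \<and> pairs W \<inter> E = {}})"
    using eventually_ge_at_top[of R]
  proof (eventually_elim, intro allI impI)
    fix n E assume n: "R \<le> n"
    let ?X = "{W. W \<subseteq> {..<n} \<and> card W = r \<and> pairs W \<subseteq> E}"
    let ?Y = "{W. W \<subseteq> {..<n} \<and> card W = s \<and> pairs W \<inter> E = {}}"
    let ?Z = "\<lambda>W. {Z. Z \<subseteq> {..<n} \<and> card Z = R \<and> W \<subseteq> Z}"
    assume X: "real (card ?X) \<le> c * real n ^ r"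
    have "{Z. Z \<subseteq> {..<n} \<and> card Z = R} \<subseteq> (\<Union>W\<in>?X. ?Z W) \<union> (\<Union>W\<in>?Y. ?Z W)"
    proof
      fix Z assume "Z \<in> {Z. Z \<subseteq> {..<n} \<and> card Z = R}"
      then have Z: "Z \<subseteq> {..<n}" "card Z = R" by auto
      then have "finite Z" using finite_subset by auto
      then obtain W where W: "W \<subseteq> Z" "card W = r \<and> clique W E \<or> card W = s \<and> indep W E"
        using R0[of Z E] Z(2) by (auto simp: R_def)
      have "pairs W \<subseteq> E" if "clique W E"
        using that by (auto simp: pairs_def clique_def card_2_iff)
      moreover have "pairs W \<inter> E = {}" if "indep W E"
        using that by (auto simp: pairs_def indep_def card_2_iff)
      ultimately have "W \<in> ?X \<or> W \<in> ?Y" using W Z(1) by auto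
      moreover have "Z \<in> ?Z W" using W(1) Z by simp
      ultimately show "Z \<in> (\<Union>W\<in>?X. ?Z W) \<union> (\<Union>W\<in>?Y. ?Z W)" by (meson UN_I UnCI)
    qed
    then have "n choose R \<le> card ((\<Union>W\<in>?X. ?Z W) \<union> (\<Union>W\<in>?Y. ?Z W))"
      using card_mono[of "(\<Union>W\<in>?X. ?Z W) \<union> (\<Union>W\<in>?Y. ?Z W)" "{Z. Z \<subseteq> {..<n} \<and> card Z = R}"]
      by (simp add: finite_bounded_subsets n_subsets)
    also have "\<dots> \<le> card (\<Union>W\<in>?X. ?Z W) + card (\<Union>W\<in>?Y. ?Z W)" by (rule card_Un_le)
    also have "card (\<Union>W\<in>?X. ?Z W) \<le> (\<Sum>W\<in>?X. n ^ (R - r))"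
    proof (rule order_trans[OF card_UN_le sum_mono])
      fix W assume "W \<in> ?X"
      then show "card (?Z W) \<le> n ^ (R - r)"
        using card_supersets_le[of W n R] finite_subset[of W "{..<n}"] by auto
    qed (rule finite_bounded_subsets)
    also have "card (\<Union>W\<in>?Y. ?Z W) \<le> (\<Sum>W\<in>?Y. n ^ (R - s))"
    proof (rule order_trans[OF card_UN_le sum_mono])
      fix W assume "W \<in> ?Y"
      then show "card (?Z W) \<le> n ^ (R - s)"
        using card_supersets_le[of W n R] finite_subset[of W "{..<n}"] by auto
    qed (rule finite_bounded_subsets)
    finally have "n choose R \<le> card ?X * n ^ (R - r) + card ?Y * n ^ (R - s)" by simp
    then have "real (n choose R) \<le> real (card ?X) * real n ^ (R - r) + real (card ?Y) * real n ^ (R - s)"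
      by (simp flip: of_nat_power of_nat_mult of_nat_add)
    moreover have "2 * (c * real n ^ R) \<le> real (n choose R)"
      using binomial_ge_n_over_k_pow_k[OF n, where ?'a = real] by (simp add: c_def power_divide)
    moreover have "real (card ?X) * real n ^ (R - r) \<le> c * real n ^ R"
    proof -
      have "real (card ?X) * real n ^ (R - r) \<le> c * real n ^ r * real n ^ (R - r)"
        using X by (intro mult_right_mono) auto
      also have "\<dots> = c * real n ^ R" by (simp add: mult.assoc R_def flip: power_add)
      finally show ?thesis .
    qed
    ultimately have "c * real n ^ R \<le> real (card ?Y) * real n ^ (R - s)" by linarith
    moreover have "c * real n ^ R = c * real n ^ s * real n ^ (R - s)"
      by (simp add: mult.assoc R_def flip: power_add)
    ultimately have "c * real n ^ s * real n ^ (R - s) \<le> real (card ?Y) * real n ^ (R - s)"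
      by simp
    then show "c * real n ^ s \<le> real (card ?Y)"
      by (rule mult_right_le_imp_le) (use n Rpos in simp)
  qed
  then show ?thesis using c by blast
qed

section \<open>Random hypergraphs\<close>

lemma pairs_bij_betw:
  assumes "bij_betw f A B"
  shows "pairs B = (\<lambda>e. f ` e) ` pairs A"
proof
  have inj: "inj_on f A" and B: "B = f ` A" using assms by (auto simp: bij_betw_def)
  show "pairs B \<subseteq> (\<lambda>e. f ` e) ` pairs A"
  proof
    fix e assume "e \<in> pairs B"
    then have "e \<subseteq> f ` A" "card e = 2" by (auto simp: pairs_def B)
    then obtain e' where e': "e' \<subseteq> A" "e = f ` e'" by (auto simp: subset_image_iff)
    then have "card e' = 2" using \<open>card e = 2\<close> inj by (simp add: card_image inj_on_subset)
    then show "e \<in> (\<lambda>e. f ` e) ` pairs A" using e' by (auto simp: pairs_def)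
  qed
  show "(\<lambda>e. f ` e) ` pairs A \<subseteq> pairs B"
    using inj by (auto simp: pairs_def B card_image inj_on_subset)
qed

lemma complete_graph_iso:
  assumes "finite W" "card W = r"
  shows "hypergraph_iso (complete_graph r) (W, pairs W)"
proof -
  obtain f where f: "bij_betw f {..<r} W"
    using finite_same_card_bij[of "{..<r}" W] assms by auto
  have "complete_graph r = ({..<r}, pairs {..<r})" by (simp add: complete_hypergraph_def pairs_def)
  then show ?thesis using f pairs_bij_betw[OF f] by (auto simp: hypergraph_iso_def)
qed

lemma edges_primal_graph: "edges (primal_graph H) = (\<Union>h\<in>edges H. pairs h)"
  by (auto simp: primal_graph_def pairs_def card_2_iff)

lemma monochromatic_copy_complete_graph:
  assumes "finite W" "card W = r" "W \<subseteq> verts H" "pairs W \<subseteq> edges (primal_graph H)"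
    and "\<And>e. e \<in> pairs W \<Longrightarrow> col e = c"
  shows "monochromatic_copy (primal_graph H) col c (complete_graph r)"
proof -
  have "subhypergraph (W, pairs W) (primal_graph H)"
    using assms(3,4) by (auto simp: subhypergraph_def) (auto simp: primal_graph_def pairs_def)
  then show ?thesis
    unfolding monochromatic_copy_def using complete_graph_iso[OF assms(1,2)] assms(5)
    by (intro exI[of _ "(W, pairs W)"]) auto
qed

text \<open>The blue graph \<open>B\<close> contains no clique of size \<open>r\<close>, so it lies
  in a container \<open>f L\<close>. A hyperedge without a blue pair would be a red clique of size
  \<open>s\<close>, so each hyperedge meets \<open>B\<close> and hence \<open>f L\<close>. One
  hyperedge chosen for each fingerprint pair gives the cover \<open>\<F>\<close>.\<close>

lemma not_ramsey_arrow_certificate: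
  assumes "2 \<le> r" and t: "0 \<le> t"
    and f: "\<forall>I\<in>indep_sets (pairs {..<n}) (cliques r n). fits t m f Q I"
    and H0: "\<And>h. h \<in> edges H0 \<Longrightarrow> h \<subseteq> verts H0 \<and> card h = s" "verts H0 \<subseteq> {..<n}"
    and nr: "\<not> ramsey_arrow (primal_graph H0) (complete_graph s) (complete_graph r)"
  obtains \<F> L where "\<F> \<subseteq> edges H0" "real (card \<F>) \<le> real m * t" "length L = m"
    "\<And>F. F \<in> set L \<Longrightarrow> F \<subseteq> (\<Union>h\<in>\<F>. pairs h)" "Q (f L)"
    "\<And>h. h \<in> edges H0 \<Longrightarrow> pairs h \<inter> f L \<noteq> {}"
proof -
  from nr obtain col where
    red: "\<not> monochromatic_copy (primal_graph H0) col Red (complete_graph s)" and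
    blue: "\<not> monochromatic_copy (primal_graph H0) col Blue (complete_graph r)"
    unfolding ramsey_arrow_def by blast
  define B where "B = {e \<in> edges (primal_graph H0). col e = Blue}"
  have finh: "finite h" if "h \<in> edges H0" for h
    using H0(1)[OF that] H0(2) by (meson finite_lessThan finite_subset)
  have Bn: "B \<subseteq> pairs {..<n}"
  proof
    fix e assume "e \<in> B"
    then obtain h where "h \<in> edges H0" "e \<in> pairs h" by (auto simp: B_def edges_primal_graph)
    then show "e \<in> pairs {..<n}" using H0(1)[of h] H0(2) by (auto simp: pairs_def)
  qed
  have hB: "pairs h \<inter> B \<noteq> {}" if h: "h \<in> edges H0" for h
  proof
    assume "pairs h \<inter> B = {}"
    then have "col e = Red" if "e \<in> pairs h" for e
      using that h by (cases "col e") (auto simp: B_def edges_primal_graph)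
    then show False
      using red monochromatic_copy_complete_graph[of h s H0 col Red] H0(1)[OF h] finh[OF h] h
      by (auto simp: edges_primal_graph)
  qed
  have "\<not> pairs W \<subseteq> B" if W: "W \<subseteq> {..<n}" "card W = r" for W
  proof
    assume WB: "pairs W \<subseteq> B"
    \<comment> \<open>As \<open>r \<ge> 2\<close>, every vertex of \<open>W\<close> lies in a blue
      pair and therefore in \<open>verts H0\<close>, as a copy inside the primal graph
      requires.\<close>
    have "W = \<Union>(pairs W)" using Union_pairs[of W] W assms(1) by simp
    also have "\<dots> \<subseteq> \<Union>B" using WB by blast
    also have "\<dots> \<subseteq> verts H0"
    proof
      fix x assume "x \<in> \<Union>B"
      then obtain h where "h \<in> edges H0" "x \<in> h" by (auto simp: B_def edges_primal_graph pairs_def)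
      then show "x \<in> verts H0" using H0(1)[of h] by auto
    qed
    finally have "monochromatic_copy (primal_graph H0) col Blue (complete_graph r)"
      using WB W by (intro monochromatic_copy_complete_graph[of W])
        (auto simp: B_def finite_subset[OF W(1)])
    then show False using blue by simp
  qed
  then have "B \<in> indep_sets (pairs {..<n}) (cliques r n)"
    using Bn by (auto simp: indep_sets_def cliques_def)
  with f have "fits t m f Q B" by (rule bspec)
  then obtain L where L: "length L = m" "\<forall>F\<in>set L. F \<subseteq> B \<and> real (card F) \<le> t" "B \<subseteq> f L" "Q (f L)"
    unfolding fits_def by (elim exE conjE)
  define T where "T = \<Union>(set L)"
  have TB: "T \<subseteq> B" using L(2) by (auto simp: T_def)
  have finT: "finite T" by (rule finite_subset[OF subset_trans[OF TB Bn]]) (simp add: finite_pairs)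
  have cT: "real (card T) \<le> real m * t"
  proof -
    have "card T \<le> sum card (set L)" unfolding T_def by (rule card_Union_le_sum_card)
    then have "real (card T) \<le> (\<Sum>F\<in>set L. real (card F))" by (simp flip: of_nat_sum)
    also have "\<dots> \<le> (\<Sum>F\<in>set L. t)" by (rule sum_mono) (use L(2) in auto)
    also have "\<dots> = real (card (set L)) * t" by simp
    also have "\<dots> \<le> real m * t"
      using card_length[of L] L(1) t by (intro mult_right_mono) auto
    finally show ?thesis .
  qed
  have "\<forall>e\<in>T. \<exists>h. h \<in> edges H0 \<and> e \<in> pairs h"
    using TB by (auto simp: B_def edges_primal_graph)
  from bchoice[OF this] obtain \<phi> where \<phi>: "\<forall>e\<in>T. \<phi> e \<in> edges H0 \<and> e \<in> pairs (\<phi> e)" ..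
  show thesis
  proof (rule that[of "\<phi> ` T" L])
    show "\<phi> ` T \<subseteq> edges H0" using \<phi> by auto
    show "real (card (\<phi> ` T)) \<le> real m * t"
      using card_image_le[OF finT, of \<phi>] cT by linarith
    show "F \<subseteq> (\<Union>h\<in>\<phi> ` T. pairs h)" if "F \<in> set L" for F
    proof
      fix e assume "e \<in> F"
      then have "e \<in> T" using that by (auto simp: T_def)
      then show "e \<in> (\<Union>h\<in>\<phi> ` T. pairs h)" using \<phi> by blast
    qed
    show "pairs h \<inter> f L \<noteq> {}" if "h \<in> edges H0" for h using hB[OF that] L(3) by auto
  qed (use L in auto)
qed

text \<open>Markov's inequality for \<open>2 powr (\<epsilon> * |H| - |H \<inter> S|)\<close> restricted to \<open>\<F> \<subseteq> H\<close>; this variable is a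
  product over the hyperedges, so no separate concentration bound for \<open>|H|\<close> is needed.\<close>

lemma prob_certificate_le:
  fixes E :: "'a set" and p \<epsilon> :: real
  assumes E: "finite E" "\<F> \<subseteq> E" "S \<subseteq> E" "\<F> \<inter> S = {}" and p: "0 \<le> p" "p \<le> 1"
    and y: "1 \<le> 2 powr \<epsilon>" "2 powr \<epsilon> \<le> 2"
  shows "measure_pmf.prob (Pi_pmf E False (\<lambda>_. bernoulli_pmf p))
      {X. \<F> \<subseteq> {e \<in> E. X e} \<and> real (card {e \<in> S. X e}) \<le> \<epsilon> * real (card {e \<in> E. X e})}
    \<le> (2 * p) ^ card \<F> * exp (p * (2 powr \<epsilon> - 1) * real (card E)) *
       exp (- p * (1 - 2 powr \<epsilon> / 2) * real (card S))" (is "measure_pmf.prob ?P ?A \<le> _")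
proof -
  define y where "y = 2 powr \<epsilon>"
  have y': "1 \<le> y" "y \<le> 2" using y by (auto simp: y_def)
  \<comment> \<open>The factor of one hyperedge: \<open>y\<close> if present, halved on
    \<open>S\<close>, and 0 if a hyperedge of \<open>\<F>\<close> is absent. On the event the
    product is at least 1.\<close>
  define g where "g e b = (if e \<in> \<F> then if b then y else 0 else if b then if e \<in> S then y / 2 else y else 1)"
    for e b
  have g0: "0 \<le> g e b" for e b using y' by (auto simp: g_def)
  have int: "integrable (measure_pmf (bernoulli_pmf p)) (g e)" for e
    by (rule integrable_measure_pmf_finite) (rule finite_subset[OF subset_UNIV], simp)
  have "measure_pmf.prob ?P ?A = measure_pmf.expectation ?P (indicator ?A)" by simp
  also have "\<dots> \<le> measure_pmf.expectation ?P (\<lambda>X. \<Prod>e\<in>E. g e (X e))"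
  proof (rule integral_mono)
    show "integrable (measure_pmf ?P) (indicator ?A :: _ \<Rightarrow> real)"
      by (rule measure_pmf.integrable_const_bound[where B = 1]) (auto simp: indicator_def)
    show "integrable (measure_pmf ?P) (\<lambda>X. \<Prod>e\<in>E. g e (X e))"
      by (rule integrable_prod_Pi_pmf) (use E int in auto)
    fix X
    show "indicator ?A X \<le> (\<Prod>e\<in>E. g e (X e))"
    proof (cases "X \<in> ?A")
      case True
      then have X: "\<And>e. e \<in> \<F> \<Longrightarrow> X e" "real (card {e \<in> S. X e}) \<le> \<epsilon> * real (card {e \<in> E. X e})"
        by auto
      have "(\<Prod>e\<in>E. g e (X e)) = (\<Prod>e\<in>E. (if X e then y else 1) * (if e \<in> S \<and> X e then 1 / 2 else 1))"
        using X(1) E(4) by (intro prod.cong refl) (auto simp: g_def)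
      also have "\<dots> = y ^ card {e \<in> E. X e} * (1 / 2) ^ card {e \<in> E. e \<in> S \<and> X e}"
        using E(1) by (simp add: prod.distrib prod.If_cases Int_def)
      also have "{e \<in> E. e \<in> S \<and> X e} = {e \<in> S. X e}" using E(3) by auto
      also have "y ^ card {e \<in> E. X e} = 2 powr (\<epsilon> * real (card {e \<in> E. X e}))"
        unfolding y_def by (simp add: powr_power mult.commute)
      also have "(1 / 2) ^ card {e \<in> S. X e} = 2 powr - real (card {e \<in> S. X e})"
        by (simp add: powr_minus powr_realpow power_one_over inverse_eq_divide)
      also have "2 powr (\<epsilon> * real (card {e \<in> E. X e})) * 2 powr - real (card {e \<in> S. X e})
          = 2 powr (\<epsilon> * real (card {e \<in> E. X e}) - real (card {e \<in> S. X e}))"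
        by (simp flip: powr_add)
      finally show ?thesis using X(2) True ge_one_powr_ge_zero[of 2] by simp
    qed (use g0 in \<open>auto intro: prod_nonneg\<close>)
  qed
  also have "\<dots> = (\<Prod>e\<in>E. measure_pmf.expectation (bernoulli_pmf p) (g e))"
    by (rule expectation_prod_Pi_pmf) (use E int g0 in auto)
  also have "\<dots> = (\<Prod>e\<in>E. g e True * p + g e False * (1 - p))"
    using p by (simp add: mult.commute)
  \<comment> \<open>Outside \<open>\<F>\<close> this is \<open>1 + x \<le> exp x\<close>; on
    \<open>\<F>\<close> the expectation is \<open>y * p \<le> 2 * p\<close>.\<close>
  also have "\<dots> \<le> (\<Prod>e\<in>E. (if e \<in> \<F> then 2 * p else 1) * exp (p * (y - 1)) *
      (if e \<in> S then exp (- p * (1 - y / 2)) else 1))"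
  proof (rule prod_mono, rule conjI)
    fix e
    show "0 \<le> g e True * p + g e False * (1 - p)" using g0 p by simp
    have e1: "1 \<le> exp (p * (y - 1))" using p y' by simp
    consider "e \<in> \<F>" | "e \<in> S" "e \<notin> \<F>" | "e \<notin> S" "e \<notin> \<F>" by blast
    then show "g e True * p + g e False * (1 - p) \<le> (if e \<in> \<F> then 2 * p else 1) * exp (p * (y - 1)) *
      (if e \<in> S then exp (- p * (1 - y / 2)) else 1)"
    proof cases
      case 1
      then have "e \<notin> S" using E(4) by auto
      have "y * p \<le> 2 * p * 1" using y' p by (simp add: mult_right_mono)
      also have "\<dots> \<le> 2 * p * exp (p * (y - 1))" using e1 p by (intro mult_left_mono) auto
      finally show ?thesis using 1 \<open>e \<notin> S\<close> by (simp add: g_def)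
    next
      case 2
      have "y / 2 * p + (1 - p) = 1 + (- p * (1 - y / 2))" by (simp add: algebra_simps)
      also have "\<dots> \<le> 1 * exp (- p * (1 - y / 2))" using exp_ge_add_one_self[of "- p * (1 - y / 2)"] by simp
      also have "\<dots> \<le> exp (p * (y - 1)) * exp (- p * (1 - y / 2))"
        using e1 by (intro mult_right_mono) auto
      finally show ?thesis using 2 by (simp add: g_def)
    next
      case 3
      have "y * p + (1 - p) = 1 + p * (y - 1)" by (simp add: algebra_simps)
      also have "\<dots> \<le> exp (p * (y - 1))" by (rule exp_ge_add_one_self)
      finally show ?thesis using 3 by (simp add: g_def)
    qed
  qed
  also have "\<dots> = (2 * p) ^ card \<F> * exp (p * (y - 1)) ^ card E * exp (- p * (1 - y / 2)) ^ card S"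
  proof -
    have "{e \<in> E. e \<in> \<F>} = \<F>" "{e \<in> E. e \<in> S} = S" using E by auto
    then show ?thesis using E(1) by (simp add: prod.distrib prod.If_cases Int_def)
  qed
  also have "\<dots> = (2 * p) ^ card \<F> * exp (p * (y - 1) * real (card E)) * exp (- p * (1 - y / 2) * real (card S))"
    by (simp only: exp_of_nat2_mult)
  finally show ?thesis unfolding y_def .
qed

section \<open>The union bound over certificates\<close>

lemma sum_power_card_Pow:
  fixes x :: "'b::comm_semiring_1"
  assumes "finite E"
  shows "(\<Sum>\<F>\<in>Pow E. x ^ card \<F>) = (1 + x) ^ card E"
  using prod_add[OF assms, of "\<lambda>_. x" "\<lambda>_. 1"] by (simp add: add.commute)

text \<open>A cover \<open>\<F>\<close> spans at most \<open>s ^ 2 * card \<F>\<close> pairs, so it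
  admits at most \<open>q ^ card \<F>\<close> lists, \<open>q = 2 ^ (s ^ 2 * m)\<close>. Each
  certificate has probability at most
  \<open>(2 * p) ^ card \<F> * exp (- (c / 8) * (p * M))\<close>. Weighting with
  \<open>\<Lambda>\<close> costs at most \<open>exp (u * ln \<Lambda>)\<close> and makes the sum
  over all \<open>\<F> \<subseteq> E\<close> at most \<open>exp (c / 16 * (p * M))\<close>, half of
  the available exponent.\<close>

lemma certificate_union_bound:
  fixes p M c \<epsilon> u :: real and E :: "nat set set" and S :: "nat set set list \<Rightarrow> nat set set"
  assumes E: "\<And>e. e \<in> E \<Longrightarrow> finite e \<and> card e = s" "finite E" "real (card E) \<le> M" and p: "0 \<le> p" "p \<le> 1"
    and c: "0 < c" and \<epsilon>: "0 \<le> \<epsilon>" "2 powr \<epsilon> \<le> 3 / 2" "2 powr \<epsilon> \<le> 1 + c / 8"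
    and \<Lambda>: "1 \<le> \<Lambda>" "2 * 2 ^ (s ^ 2 * m) / \<Lambda> \<le> c / 16"
  shows "measure_pmf.prob (Pi_pmf E False (\<lambda>_. bernoulli_pmf p))
     {X. \<exists>\<F> L. \<F> \<subseteq> {e \<in> E. X e} \<and> real (card \<F>) \<le> u \<and> length L = m \<and>
          set L \<subseteq> Pow (\<Union>h\<in>\<F>. pairs h) \<and> S L \<subseteq> E \<and> c * M \<le> real (card (S L)) \<and> \<F> \<inter> S L = {} \<and>
          real (card {e \<in> S L. X e}) \<le> \<epsilon> * real (card {e \<in> E. X e})}
    \<le> exp (u * ln \<Lambda> - c / 16 * (p * M))" (is "measure_pmf.prob ?P ?A \<le> _")
proof -
  define q where "q = (2::real) ^ (s ^ 2 * m)"
  define A where "A \<F> L = {X. S L \<subseteq> E \<and> c * M \<le> real (card (S L)) \<and> \<F> \<inter> S L = {} \<and>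
      \<F> \<subseteq> {e \<in> E. X e} \<and> real (card {e \<in> S L. X e}) \<le> \<epsilon> * real (card {e \<in> E. X e})}" for \<F> L
  define LL where "LL \<F> = {L. set L \<subseteq> Pow (\<Union>h\<in>\<F>. pairs h) \<and> length L = m}" for \<F> :: "nat set set"
  define \<FF> where "\<FF> = {\<F> \<in> Pow E. real (card \<F>) \<le> u}"
  have M0: "0 \<le> M" using E(3) by (meson of_nat_0_le_iff order_trans)
  have fin\<FF>: "finite \<FF>" using E(2) by (simp add: \<FF>_def)
  have \<FF>E: "\<F> \<subseteq> E" "finite \<F>" if "\<F> \<in> \<FF>" for \<F>
    using that E(2) by (auto simp: \<FF>_def dest: finite_subset)
  have finp: "finite (\<Union>h\<in>\<F>. pairs h)" if "\<F> \<in> \<FF>" for \<F>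
    using \<FF>E[OF that] E(1) by (intro finite_UN_I finite_pairs) auto
  have finLL: "finite (LL \<F>)" if "\<F> \<in> \<FF>" for \<F>
    unfolding LL_def using finp[OF that] by (intro finite_lists_length_eq) simp
  have cLL: "real (card (LL \<F>)) \<le> q ^ card \<F>" if "\<F> \<in> \<FF>" for \<F>
  proof -
    have "card (\<Union>h\<in>\<F>. pairs h) \<le> (\<Sum>h\<in>\<F>. card (pairs h))"
      by (rule card_UN_le) (use \<FF>E[OF that] in simp)
    also have "\<dots> \<le> (\<Sum>h\<in>\<F>. s ^ 2)"
      using \<FF>E[OF that] E(1) by (intro sum_mono) (auto simp: card_pairs binomial_le_power subset_iff)
    finally have "card (\<Union>h\<in>\<F>. pairs h) \<le> s ^ 2 * card \<F>" by (simp add: mult.commute)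
    then have "(2::real) ^ card (\<Union>h\<in>\<F>. pairs h) \<le> 2 ^ (s ^ 2 * card \<F>)"
      by (intro power_increasing) auto
    then have "((2::real) ^ card (\<Union>h\<in>\<F>. pairs h)) ^ m \<le> (2 ^ (s ^ 2 * card \<F>)) ^ m"
      by (intro power_mono) auto
    also have "\<dots> = q ^ card \<F>" by (simp add: q_def mult_ac flip: power_mult)
    also have "((2::real) ^ card (\<Union>h\<in>\<F>. pairs h)) ^ m = real (card (LL \<F>))"
      unfolding LL_def using finp[OF that] by (subst card_lists_length_eq) (auto simp: card_Pow)
    finally show ?thesis .
  qed
  have PA: "measure_pmf.prob ?P (A \<F> L) \<le> (2 * p) ^ card \<F> * exp (- (c / 8) * (p * M))"
    if "\<F> \<in> \<FF>" for \<F> L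
  \<comment> \<open>These conditions do not involve \<open>X\<close>; if they fail, the event is
    empty.\<close>
  proof (cases "S L \<subseteq> E \<and> c * M \<le> real (card (S L)) \<and> \<F> \<inter> S L = {}")
    case True
    have "measure_pmf.prob ?P (A \<F> L) \<le> (2 * p) ^ card \<F> * exp (p * (2 powr \<epsilon> - 1) * real (card E)) *
       exp (- p * (1 - 2 powr \<epsilon> / 2) * real (card (S L)))"
      using prob_certificate_le[of E \<F> "S L" p \<epsilon>] E(2) \<FF>E[OF that] True p \<epsilon> ge_one_powr_ge_zero[of 2 \<epsilon>]
      by (simp add: A_def)
    also have "\<dots> \<le> (2 * p) ^ card \<F> * exp (p * (c / 8) * M) * exp (- p * (1 / 4) * (c * M))"
    proof (intro mult_mono)
      have "p * (2 powr \<epsilon> - 1) * real (card E) \<le> p * (c / 8) * M"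
        using p \<epsilon> E(3) c ge_one_powr_ge_zero[of 2 \<epsilon>] by (intro mult_mono) auto
      then show "exp (p * (2 powr \<epsilon> - 1) * real (card E)) \<le> exp (p * (c / 8) * M)" by simp
      have "p * (1 / 4) * (c * M) \<le> p * (1 - 2 powr \<epsilon> / 2) * real (card (S L))"
        using p \<epsilon> True c M0 by (intro mult_mono) auto
      then show "exp (- p * (1 - 2 powr \<epsilon> / 2) * real (card (S L))) \<le> exp (- p * (1 / 4) * (c * M))"
        by simp
    qed (use p in auto)
    also have "\<dots> = (2 * p) ^ card \<F> * exp (- (c / 8) * (p * M))"
      by (simp add: algebra_simps flip: exp_add)
    finally show ?thesis .
  next
    case False
    then have "A \<F> L = {}" by (auto simp: A_def)
    then show ?thesis using p by simp
  qed
  have sub: "?A \<subseteq> (\<Union>\<F>\<in>\<FF>. \<Union>L\<in>LL \<F>. A \<F> L)"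
  proof
    fix X assume "X \<in> ?A"
    then obtain \<F> L where *: "\<F> \<subseteq> {e \<in> E. X e}" "real (card \<F>) \<le> u" "length L = m"
      "set L \<subseteq> Pow (\<Union>h\<in>\<F>. pairs h)" "S L \<subseteq> E" "c * M \<le> real (card (S L))" "\<F> \<inter> S L = {}"
      "real (card {e \<in> S L. X e}) \<le> \<epsilon> * real (card {e \<in> E. X e})" by (elim CollectE exE conjE)
    then have "\<F> \<in> \<FF>" "L \<in> LL \<F>" "X \<in> A \<F> L" by (auto simp: \<FF>_def LL_def A_def)
    then show "X \<in> (\<Union>\<F>\<in>\<FF>. \<Union>L\<in>LL \<F>. A \<F> L)" by (intro UN_I)
  qed
  have "measure_pmf.prob ?P ?A \<le> measure_pmf.prob ?P (\<Union>\<F>\<in>\<FF>. \<Union>L\<in>LL \<F>. A \<F> L)"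
    by (rule measure_pmf.finite_measure_mono[OF sub]) simp
  also have "\<dots> \<le> (\<Sum>\<F>\<in>\<FF>. measure_pmf.prob ?P (\<Union>L\<in>LL \<F>. A \<F> L))"
    by (rule measure_UNION_le[OF fin\<FF>]) simp
  also have "\<dots> \<le> (\<Sum>\<F>\<in>\<FF>. exp (u * ln \<Lambda>) * exp (- (c / 8) * (p * M)) * (2 * p * q / \<Lambda>) ^ card \<F>)"
  proof (rule sum_mono)
    fix \<F> assume \<F>: "\<F> \<in> \<FF>"
    have "measure_pmf.prob ?P (\<Union>L\<in>LL \<F>. A \<F> L) \<le> (\<Sum>L\<in>LL \<F>. measure_pmf.prob ?P (A \<F> L))"
      by (rule measure_UNION_le[OF finLL[OF \<F>]]) simp
    also have "\<dots> \<le> (\<Sum>L\<in>LL \<F>. (2 * p) ^ card \<F> * exp (- (c / 8) * (p * M)))"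
      by (rule sum_mono) (rule PA[OF \<F>])
    also have "\<dots> = real (card (LL \<F>)) * ((2 * p) ^ card \<F> * exp (- (c / 8) * (p * M)))" by simp
    also have "\<dots> \<le> q ^ card \<F> * ((2 * p) ^ card \<F> * exp (- (c / 8) * (p * M)))"
      using p by (intro mult_right_mono cLL[OF \<F>]) auto
    also have "\<dots> = \<Lambda> ^ card \<F> * (exp (- (c / 8) * (p * M)) * (2 * p * q / \<Lambda>) ^ card \<F>)"
      using \<Lambda>(1) by (simp add: power_mult_distrib power_divide)
    also have "\<dots> \<le> exp (u * ln \<Lambda>) * (exp (- (c / 8) * (p * M)) * (2 * p * q / \<Lambda>) ^ card \<F>)"
    proof (rule mult_right_mono)
      have "\<Lambda> ^ card \<F> = exp (real (card \<F>) * ln \<Lambda>)"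
        using \<Lambda>(1) by (simp add: exp_of_nat_mult)
      also have "\<dots> \<le> exp (u * ln \<Lambda>)"
        using \<F> \<Lambda>(1) by (simp add: \<FF>_def mult_right_mono)
      finally show "\<Lambda> ^ card \<F> \<le> exp (u * ln \<Lambda>)" .
      show "0 \<le> exp (- (c / 8) * (p * M)) * (2 * p * q / \<Lambda>) ^ card \<F>"
        using p \<Lambda>(1) by (simp add: q_def)
    qed
    finally show "measure_pmf.prob ?P (\<Union>L\<in>LL \<F>. A \<F> L)
        \<le> exp (u * ln \<Lambda>) * exp (- (c / 8) * (p * M)) * (2 * p * q / \<Lambda>) ^ card \<F>"
      by (simp only: mult.assoc)
  qed
  also have "\<dots> = exp (u * ln \<Lambda>) * exp (- (c / 8) * (p * M)) * (\<Sum>\<F>\<in>\<FF>. (2 * p * q / \<Lambda>) ^ card \<F>)"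
    by (simp add: sum_distrib_left)
  also have "\<dots> \<le> exp (u * ln \<Lambda>) * exp (- (c / 8) * (p * M)) * exp (c / 16 * (p * M))"
  proof (rule mult_left_mono)
    have x0: "0 \<le> 2 * p * q / \<Lambda>" using p \<Lambda>(1) by (simp add: q_def)
    have "(\<Sum>\<F>\<in>\<FF>. (2 * p * q / \<Lambda>) ^ card \<F>) \<le> (\<Sum>\<F>\<in>Pow E. (2 * p * q / \<Lambda>) ^ card \<F>)"
      by (rule sum_mono2) (use E(2) x0 in \<open>auto simp: \<FF>_def\<close>)
    also have "\<dots> = (1 + 2 * p * q / \<Lambda>) ^ card E" by (rule sum_power_card_Pow[OF E(2)])
    also have "\<dots> \<le> exp (2 * p * q / \<Lambda>) ^ card E"
      using x0 by (intro power_mono exp_ge_add_one_self) auto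
    also have "\<dots> = exp (p * (2 * q / \<Lambda>) * real (card E))" 
      unfolding exp_of_nat2_mult[symmetric] by (simp add: mult_ac)
    also have "p * (2 * q / \<Lambda>) * real (card E) \<le> p * (c / 16) * M"
      using p \<Lambda> E(3) c by (intro mult_mono) (auto simp: q_def)
    finally show "(\<Sum>\<F>\<in>\<FF>. (2 * p * q / \<Lambda>) ^ card \<F>) \<le> exp (c / 16 * (p * M))" by (simp add: mult_ac)
  qed simp
  also have "\<dots> = exp (u * ln \<Lambda> - c / 16 * (p * M))"
    by (simp add: algebra_simps flip: exp_add)
  finally show ?thesis .
qed

theorem theorem2p4:
  fixes s k :: nat
  assumes "s \<ge> 2" and "k \<ge> 3"
  shows "\<exists>C::real. C > 0 \<and>
    (\<forall>p :: nat \<Rightarrow> real.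
      (\<forall>n. 0 \<le> p n \<and> p n \<le> 1) \<longrightarrow>
      (\<forall>\<^sub>F n in sequentially.
         p n \<ge> C * real n powr (2 - real s - 1 / max_2_density (complete_graph (k - 1)))) \<longrightarrow>
      (\<forall>\<epsilon> :: nat \<Rightarrow> real. \<epsilon> \<longlonglongrightarrow> 0 \<longrightarrow>
        (\<lambda>n. measure_pmf.prob (random_hypergraph s n (p n))
           {H. \<forall>H0. subhypergraph H0 H \<and>
                     real (card (edges H0)) \<ge> (1 - \<epsilon> n) * real (card (edges H)) \<longrightarrow>
                     ramsey_arrow (primal_graph H0) (complete_graph s) (complete_graph (k - 1))})
          \<longlonglongrightarrow> 1))"
proof -
  define r where "r = k - 1"
  define a where "a = 1 / max_2_density (complete_graph r)"
  have r: "2 \<le> r" using assms(2) by (simp add: r_def)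
  have a1: "a \<le> 1" by (rule inverse_max_2_density(2)[OF r a_def])
  define E where "E n = {e. e \<subseteq> {..<n} \<and> card e = s}" for n :: nat
  define S where "S n C = {W. W \<subseteq> {..<n} \<and> card W = s \<and> pairs W \<inter> C = {}}" for n :: nat and C
  from few_cliques_imp_many_indep[OF assms(1) r] obtain c where c: "0 < c" and
    many: "\<forall>\<^sub>F n in sequentially. \<forall>C.
      real (card {W. W \<subseteq> {..<n} \<and> card W = r \<and> pairs W \<subseteq> C}) \<le> c * real n ^ r \<longrightarrow>
      c * real n ^ s \<le> real (card (S n C))"
    unfolding S_def by (elim exE conjE)
  from clique_free_containers[OF r c a_def] obtain m K where K: "0 < K" and
    cont: "\<forall>\<^sub>F n in sequentially.
      has_containers (K * real n powr (2 - a)) m (indep_sets (pairs {..<n}) (cliques r n))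
        (\<lambda>C. real (card {W. W \<subseteq> {..<n} \<and> card W = r \<and> pairs W \<subseteq> C}) \<le> c * real n ^ r)"
    by (elim exE conjE)
  define q where "q = (2::real) ^ (s ^ 2 * m)"
  define \<Lambda> where "\<Lambda> = max 1 (32 * q / c)"
  have q: "0 < q" by (simp add: q_def)
  have \<Lambda>: "1 \<le> \<Lambda>" "2 * q / \<Lambda> \<le> c / 16"
  proof -
    show "1 \<le> \<Lambda>" by (simp add: \<Lambda>_def)
    moreover have "32 * q / c \<le> \<Lambda>" by (simp add: \<Lambda>_def)
    ultimately show "2 * q / \<Lambda> \<le> c / 16" using c by (simp add: field_simps)
  qed
  \<comment> \<open>A fixed threshold that \<open>\<epsilon> n\<close> eventually undercuts. It
    keeps \<open>2 powr \<epsilon>0\<close> so close to 1 that the gain on \<open>S\<close>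
    outweighs the loss on all of \<open>E\<close>.\<close>
  define \<epsilon>0 where "\<epsilon>0 = log 2 (1 + min (c / 8) (1 / 2))"
  have \<epsilon>0: "0 < \<epsilon>0" "2 powr \<epsilon>0 \<le> 3 / 2" "2 powr \<epsilon>0 \<le> 1 + c / 8"
    using c by (auto simp: \<epsilon>0_def)
  \<comment> \<open>The first summand bounds the entropy term
    \<open>m * K * N * ln \<Lambda>\<close> by \<open>c / 32 * (p * M)\<close>, half of the exponent
    \<open>c / 16 * (p * M)\<close>. The summand 1 ensures \<open>p * M \<ge> N\<close>.\<close>
  define Cc where "Cc = 32 * (real m * K * ln \<Lambda>) / c + 1"
  have Cc: "1 \<le> Cc" using K c \<Lambda>(1) by (simp add: Cc_def)
  have main: "\<forall>\<^sub>F n in sequentially. 1 - exp (- (c / 32) * real n) \<le>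
        measure_pmf.prob (random_hypergraph s n (p n))
           {H. \<forall>H0. subhypergraph H0 H \<and>
                     real (card (edges H0)) \<ge> (1 - \<epsilon> n) * real (card (edges H)) \<longrightarrow>
                     ramsey_arrow (primal_graph H0) (complete_graph s) (complete_graph r)}"
    if p: "\<forall>n. 0 \<le> p n \<and> p n \<le> 1"
      and pC: "\<forall>\<^sub>F n in sequentially. p n \<ge> Cc * real n powr (2 - real s - a)"
      and \<epsilon>: "\<epsilon> \<longlonglongrightarrow> 0"
    for p \<epsilon> :: "nat \<Rightarrow> real"
    using many cont pC order_tendstoD(2)[OF \<epsilon> \<epsilon>0(1)] eventually_ge_at_top[of 1]
  proof eventually_elim
    case (elim n)
    define M where "M = real n ^ s"
    define N where "N = real n powr (2 - a)"
    define P where "P = Pi_pmf (E n) False (\<lambda>_. bernoulli_pmf (p n))"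
    define hyp where "hyp X = ({..<n}, {e \<in> E n. X e})" for X
    let ?G = "{H. \<forall>H0. subhypergraph H0 H \<and>
                     real (card (edges H0)) \<ge> (1 - \<epsilon> n) * real (card (edges H)) \<longrightarrow>
                     ramsey_arrow (primal_graph H0) (complete_graph s) (complete_graph r)}"
    let ?Q = "\<lambda>C. real (card {W. W \<subseteq> {..<n} \<and> card W = r \<and> pairs W \<subseteq> C}) \<le> c * real n ^ r"
    from elim(2) obtain f where
      f: "\<forall>I\<in>indep_sets (pairs {..<n}) (cliques r n). fits (K * N) m f ?Q I"
      unfolding has_containers_def N_def ..
    have finE: "finite (E n)" unfolding E_def by (rule finite_bounded_subsets)
    have cE: "real (card (E n)) \<le> M"
      using binomial_le_power[of n s] by (simp add: E_def M_def n_subsets flip: of_nat_power)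
    \<comment> \<open>Uses \<open>a \<le> 1\<close>. The exponent is thus at least linear in
      \<open>n\<close>, so the failure probability tends to 0.\<close>
    have N0: "real n \<le> N"
      using powr_mono[of 1 "2 - a" "real n"] elim(5) a1 by (simp add: N_def)
    have pM: "Cc * N \<le> p n * M"
    proof -
      have "N = real n powr (2 - real s - a) * M"
        using elim(5) by (simp add: N_def M_def flip: powr_realpow powr_add)
      then have "Cc * N = Cc * real n powr (2 - real s - a) * M" by simp
      also have "\<dots> \<le> p n * M" using elim(3) by (intro mult_right_mono) (auto simp: M_def)
      finally show ?thesis .
    qed
    define B where "B = {X. \<exists>\<F> L. \<F> \<subseteq> {e \<in> E n. X e} \<and> real (card \<F>) \<le> real m * (K * N) \<and>
        length L = m \<and> set L \<subseteq> Pow (\<Union>h\<in>\<F>. pairs h) \<and> S n (f L) \<subseteq> E n \<and>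
        c * M \<le> real (card (S n (f L))) \<and> \<F> \<inter> S n (f L) = {} \<and>
        real (card {e \<in> S n (f L). X e}) \<le> \<epsilon>0 * real (card {e \<in> E n. X e})}"
    have "measure_pmf.prob P B \<le> exp (real m * (K * N) * ln \<Lambda> - c / 16 * (p n * M))"
      unfolding P_def B_def
      by (rule certificate_union_bound[where s = s])
        (use finE cE p c \<epsilon>0 \<Lambda> in \<open>auto simp: E_def q_def intro: finite_subset\<close>)
    also have "\<dots> \<le> exp (- (c / 32) * real n)"
    proof -
      have "real m * (K * N) * ln \<Lambda> \<le> c / 32 * (Cc * N)"
        using c N0 by (simp add: Cc_def field_simps)
      also have "\<dots> \<le> c / 32 * (p n * M)" using pM c by (intro mult_left_mono) auto
      finally have "real m * (K * N) * ln \<Lambda> - c / 16 * (p n * M) \<le> - (c / 32 * (p n * M))" by linarith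
      moreover have "c / 32 * real n \<le> c / 32 * (p n * M)"
      proof (rule mult_left_mono)
        have "1 * real n \<le> Cc * N" using Cc N0 by (intro mult_mono) auto
        then show "real n \<le> p n * M" using pM by linarith
      qed (use c in simp)
      ultimately show ?thesis by simp
    qed
    finally have PB: "measure_pmf.prob P B \<le> exp (- (c / 32) * real n)" .
    have "- (hyp -` ?G) \<subseteq> B"
    proof
      fix X assume "X \<in> - (hyp -` ?G)"
      then obtain H0 where sub: "subhypergraph H0 (hyp X)"
        and card0: "real (card (edges H0)) \<ge> (1 - \<epsilon> n) * real (card {e \<in> E n. X e})"
        and nr: "\<not> ramsey_arrow (primal_graph H0) (complete_graph s) (complete_graph r)"
        by (auto simp: hyp_def)
      have e0: "edges H0 \<subseteq> {e \<in> E n. X e}" using sub by (auto simp: subhypergraph_def hyp_def)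
      have t0: "0 \<le> K * N" using K N0 by simp
      have "h \<subseteq> verts H0 \<and> card h = s" if "h \<in> edges H0" for h
        using sub that by (auto simp: subhypergraph_def hyp_def E_def)
      moreover have "verts H0 \<subseteq> {..<n}" using sub by (simp add: subhypergraph_def hyp_def)
      ultimately obtain \<F> L where \<F>: "\<F> \<subseteq> edges H0" "real (card \<F>) \<le> real m * (K * N)"
        and L: "length L = m" "\<And>F. F \<in> set L \<Longrightarrow> F \<subseteq> (\<Union>h\<in>\<F>. pairs h)" "?Q (f L)"
        and hit: "\<And>h. h \<in> edges H0 \<Longrightarrow> pairs h \<inter> f L \<noteq> {}"
        using not_ramsey_arrow_certificate[OF r t0 f _ _ nr] by blast
      \<comment> \<open>Every hyperedge of \<open>H0\<close> contains a pair from the container,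
        while members of \<open>S n (f L)\<close> contain none. Hence hyperedges of
        \<open>hyp X\<close> in \<open>S n (f L)\<close> are among the deleted ones, at most an
        \<open>\<epsilon> n\<close> fraction.\<close>
      have disj: "edges H0 \<inter> S n (f L) = {}" using hit by (auto simp: S_def)
      have SE: "S n (f L) \<subseteq> E n" by (auto simp: S_def E_def)
      have "card (edges H0) + card {e \<in> S n (f L). X e} = card (edges H0 \<union> {e \<in> S n (f L). X e})"
        using disj e0 SE finE by (intro card_Un_disjoint[symmetric]) (auto intro: finite_subset)
      also have "\<dots> \<le> card {e \<in> E n. X e}"
        by (rule card_mono) (use finE e0 SE in auto)
      finally have "real (card (edges H0)) + real (card {e \<in> S n (f L). X e}) \<le> real (card {e \<in> E n. X e})"
        by (simp flip: of_nat_add)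
      then have "real (card {e \<in> S n (f L). X e}) \<le> \<epsilon> n * real (card {e \<in> E n. X e})"
        using card0 by (simp add: algebra_simps)
      also have "\<dots> \<le> \<epsilon>0 * real (card {e \<in> E n. X e})"
        using elim(4) by (intro mult_right_mono) auto
      finally have "real (card {e \<in> S n (f L). X e}) \<le> \<epsilon>0 * real (card {e \<in> E n. X e})" .
      moreover have "c * M \<le> real (card (S n (f L)))" using elim(1) L(3) by (simp add: M_def)
      moreover have "\<F> \<inter> S n (f L) = {}" "\<F> \<subseteq> {e \<in> E n. X e}" using \<F>(1) disj e0 by auto
      moreover have "set L \<subseteq> Pow (\<Union>h\<in>\<F>. pairs h)" using L(2) by auto
      ultimately show "X \<in> B" unfolding B_def using \<F>(2) L(1) SE
        by (intro CollectI exI[of _ \<F>] exI[of _ L] conjI)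
    qed
    then have "measure_pmf.prob P (- (hyp -` ?G)) \<le> measure_pmf.prob P B"
      by (rule measure_pmf.finite_measure_mono) simp
    moreover have "measure_pmf.prob P (- (hyp -` ?G)) = 1 - measure_pmf.prob P (hyp -` ?G)"
      using measure_pmf.prob_compl[of "hyp -` ?G" P] by (simp add: Compl_eq_Diff_UNIV)
    moreover have "random_hypergraph s n (p n) = map_pmf hyp P"
      unfolding random_hypergraph_def P_def hyp_def[abs_def] by (simp add: complete_hypergraph_def E_def)
    ultimately show ?case using PB by (simp add: measure_map_pmf)
  qed
  have lim: "(\<lambda>n. 1 - exp (- (c / 32) * real n)) \<longlonglongrightarrow> 1"
  proof -
    have "(\<lambda>n. exp (- (c / 32)) ^ n) \<longlonglongrightarrow> 0" by (rule LIMSEQ_realpow_zero) (use c in auto)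
    from tendsto_diff[OF tendsto_const[of 1] this] show ?thesis by (simp flip: exp_of_nat2_mult)
  qed
  show ?thesis
  proof (intro exI[of _ Cc] conjI allI impI)
    show "0 < Cc" using Cc by simp
    fix p \<epsilon> :: "nat \<Rightarrow> real"
    assume "\<forall>n. 0 \<le> p n \<and> p n \<le> 1"
      "\<forall>\<^sub>F n in sequentially. p n \<ge> Cc * real n powr (2 - real s - 1 / max_2_density (complete_graph (k - 1)))"
      "\<epsilon> \<longlonglongrightarrow> 0"
    then have "\<forall>\<^sub>F n in sequentially. 1 - exp (- (c / 32) * real n) \<le>
        measure_pmf.prob (random_hypergraph s n (p n))
           {H. \<forall>H0. subhypergraph H0 H \<and>
                     real (card (edges H0)) \<ge> (1 - \<epsilon> n) * real (card (edges H)) \<longrightarrow>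
                     ramsey_arrow (primal_graph H0) (complete_graph s) (complete_graph (k - 1))}"
      using main[of p \<epsilon>] by (simp add: a_def r_def)
    then show "(\<lambda>n. measure_pmf.prob (random_hypergraph s n (p n))
           {H. \<forall>H0. subhypergraph H0 H \<and>
                     real (card (edges H0)) \<ge> (1 - \<epsilon> n) * real (card (edges H)) \<longrightarrow>
                     ramsey_arrow (primal_graph H0) (complete_graph s) (complete_graph (k - 1))})
          \<longlonglongrightarrow> 1"
      by (rule tendsto_sandwich[OF _ always_eventually lim tendsto_const]) simp
  qed
qed

end
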